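(* The functors $\mathbb{O}/\mathbb{R}$ and $\mathrm{End}_{\mathbb{Z}_2}(\mathbb{Z}_2[\mathbb{A}^{(\ )}])$ on the category $\mathbb{B}$ of finite sets and bijections are naturally isomorphic as Boole-Weyl algebra valued functors; that is, there are $\mathbb{Z}_2$-algebra isomorphisms $\mathbb{O}/\mathbb{R}(x)\simeq\mathrm{End}_{\mathbb{Z}_2}(\mathbb{Z}_2[\mathbb{A}^x])$, for finite sets $x$, natural in $x\in\mathbb{B}$.
   Context: $\mathbb{Z}_2=\{0,1\}$ is the field with two elements. For a finite set $x$, $\mathbb{Z}_2^x$ is the set of maps $x\to\mathbb{Z}_2$ and $\mathbb{Z}_2[\mathbb{A}^x]$ is the $\mathbb{Z}_2$-algebra of (regular, equivalently all) maps $\mathbb{Z}_2^x\to\mathbb{Z}_2$ with pointwise operations. Each $a\in x$ defines the coordinate function $g\mapsto g(a)$ on $\mathbb{Z}_2^x$, and the Boolean partial derivative along $a$ is $(\partial_af)(g)=f(g+e_a)+f(g)$, where $e_a\in\mathbb{Z}_2^x$ is the indicator function of $\{a\}$. $\mathrm{End}_{\mathbb{Z}_2}(\mathbb{Z}_2[\mathbb{A}^x])$ is the algebra of $\mathbb{Z}_2$-linear endomorphisms with composition as product. Operators (words): let $\widetilde x=\{\widetilde a\mid a\in x\}$ be a disjoint copy of $x$. The set $\mathbb{O}(x)$ is defined recursively as the set of formal words with $x\sqcup\widetilde x\subseteq\mathbb{O}(x)$, $0,1\in\mathbb{O}(x)$, and if $p,q\in\mathbb{O}(x)$ then the words $(pq)$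 and $(p+q)$ are in $\mathbb{O}(x)$. The valuation map $\widehat{(\ )}:\mathbb{O}(x)\to\mathrm{End}_{\mathbb{Z}_2}(\mathbb{Z}_2[\mathbb{A}^x])$ is defined by: $\widehat a$ is multiplication by the coordinate function of $a$, $\widehat{\widetilde a}=\partial_a$ for $a\in x$, $\widehat{p+q}=\widehat p+\widehat q$, $\widehat{pq}=\widehat p\,\widehat q$, $\widehat 0$ is the zero operator, $\widehat 1$ is the identity. The equivalence relation $\mathbb{R}(x)$ on $\mathbb{O}(x)$ is: $p\,\mathbb{R}(x)\,q$ if and only if $\widehat p=\widehat q$. $\mathbb{O}/\mathbb{R}(x)$ is the quotient set $\mathbb{O}(x)/\mathbb{R}(x)$ with the sum and product induced by the connectives $+$ and $.$ and the constants $0,1$. Functoriality: a bijection $\sigma:x\to y$ acts on $\mathbb{O}$ by renaming letters, $a\mapsto\sigma(a)$, $\widetilde a\mapsto\widetilde{\sigma(a)}$, and acts on endomorphisms by $T\mapsto\sigma_*T\sigma_*^{-1}$, where $\sigma_*:\mathbb{Z}_2[\mathbb{A}^x]\to\mathbb{Z}_2[\mathbb{A}^y]$ is $(\sigma_*f)(g)=f(g\circ\sigma)$ for $g\in\mathbb{Z}_2^y$. A Boole-Weyl algebra is a $\mathbb{Z}_2$-algebra with generators $x_a,y_a$ ($a$ in a finite set) and relations $x_a^2=x_a$, $y_a^2=0$, $y_ax_a=x_ay_a+y_a+1$, $x_ax_b=x_bx_a$, $y_ay_b=y_by_a$, and $y_ax_b=x_by_a$ for $a\ne b$; in $\mathrm{End}_{\mathbb{Z}_2}(\mathbb{Z}_2[\mathbb{A}^x])$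 the roles of $x_a$ and $y_a$ are played by multiplication by the coordinate $a$ and by $\partial_a$. *)

theory Defs
  imports "HOL-Algebra.QuotRing" "HOL-Algebra.Module" "HOL-Library.Z2"
begin

section \<open>Algebras over the field with two elements\<close>

definition F2 :: "bit ring" where
  "F2 = \<lparr>carrier = UNIV, mult = (*), one = 1, zero = 0, add = (+)\<rparr>"

text \<open>Associative and unital, but not necessarily commutative: the library locale
  \<open>algebra\<close> is restricted to commutative algebras.\<close>

definition z2_algebra :: "(bit, 'm) module \<Rightarrow> bool" where
  "z2_algebra A \<longleftrightarrow> module F2 A \<and> ring A \<and>
     (\<forall>c. \<forall>u\<in>carrier A. \<forall>v\<in>carrier A.
        (c \<odot>\<^bsub>A\<^esub> u) \<otimes>\<^bsub>A\<^esub> v = c \<odot>\<^bsub>A\<^esub> (u \<otimes>\<^bsub>A\<^esub> v) \<and>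
        u \<otimes>\<^bsub>A\<^esub> (c \<odot>\<^bsub>A\<^esub> v) = c \<odot>\<^bsub>A\<^esub> (u \<otimes>\<^bsub>A\<^esub> v))"

definition z2_alg_hom :: "(bit, 'm) module \<Rightarrow> (bit, 'n) module \<Rightarrow> ('m \<Rightarrow> 'n) set" where
  "z2_alg_hom A B =
     {h \<in> ring_hom A B. \<forall>c. \<forall>u\<in>carrier A. h (c \<odot>\<^bsub>A\<^esub> u) = c \<odot>\<^bsub>B\<^esub> h u}"

definition z2_alg_iso :: "(bit, 'm) module \<Rightarrow> (bit, 'n) module \<Rightarrow> ('m \<Rightarrow> 'n) set" where
  "z2_alg_iso A B = z2_alg_hom A B \<inter> ring_iso A B"

text \<open>The algebra of linear endomorphisms of a module; endomorphisms are extensional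
  functions, so that equality in the algebra is equality of maps on the carrier.\<close>

definition End_algebra :: "(bit, 'm) module \<Rightarrow> (bit, 'm \<Rightarrow> 'm) module" where
  "End_algebra M =
    \<lparr>carrier = {T \<in> carrier M \<rightarrow>\<^sub>E carrier M.
        (\<forall>u\<in>carrier M. \<forall>v\<in>carrier M. T (u \<oplus>\<^bsub>M\<^esub> v) = T u \<oplus>\<^bsub>M\<^esub> T v) \<and>
        (\<forall>c. \<forall>u\<in>carrier M. T (c \<odot>\<^bsub>M\<^esub> u) = c \<odot>\<^bsub>M\<^esub> T u)},
     mult = (\<lambda>S T. compose (carrier M) S T),
     one = (\<lambda>u\<in>carrier M. u),
     zero = (\<lambda>u\<in>carrier M. \<zero>\<^bsub>M\<^esub>),
     add = (\<lambda>S T. \<lambda>u\<in>carrier M. S u \<oplus>\<^bsub>M\<^esub> T u),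
     smult = (\<lambda>c T. \<lambda>u\<in>carrier M. c \<odot>\<^bsub>M\<^esub> T u)\<rparr>"

section \<open>Boolean functions\<close>

definition cube :: "'a set \<Rightarrow> ('a \<Rightarrow> bit) set" where
  "cube x = x \<rightarrow>\<^sub>E UNIV"

definition bool_functions :: "'a set \<Rightarrow> (bit, ('a \<Rightarrow> bit) \<Rightarrow> bit) module" where
  "bool_functions x =
    \<lparr>carrier = cube x \<rightarrow>\<^sub>E UNIV,
     mult = (\<lambda>f h. \<lambda>g\<in>cube x. f g * h g),
     one = (\<lambda>g\<in>cube x. 1),
     zero = (\<lambda>g\<in>cube x. 0),
     add = (\<lambda>f h. \<lambda>g\<in>cube x. f g + h g),
     smult = (\<lambda>c f. \<lambda>g\<in>cube x. c * f g)\<rparr>"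

definition coord :: "'a set \<Rightarrow> 'a \<Rightarrow> ('a \<Rightarrow> bit) \<Rightarrow> bit" where
  "coord x a = (\<lambda>g\<in>cube x. g a)"

definition unit_vec :: "'a set \<Rightarrow> 'a \<Rightarrow> 'a \<Rightarrow> bit" where
  "unit_vec x a = (\<lambda>b\<in>x. if b = a then 1 else 0)"

definition coord_mult :: "'a set \<Rightarrow> 'a \<Rightarrow> (('a \<Rightarrow> bit) \<Rightarrow> bit) \<Rightarrow> (('a \<Rightarrow> bit) \<Rightarrow> bit)" where
  "coord_mult x a =
     (\<lambda>f\<in>carrier (bool_functions x). coord x a \<otimes>\<^bsub>bool_functions x\<^esub> f)"

definition bool_deriv :: "'a set \<Rightarrow> 'a \<Rightarrow> (('a \<Rightarrow> bit) \<Rightarrow> bit) \<Rightarrow> (('a \<Rightarrow> bit) \<Rightarrow> bit)" where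
  "bool_deriv x a =
     (\<lambda>f\<in>carrier (bool_functions x). \<lambda>g\<in>cube x. f (\<lambda>b\<in>x. g b + unit_vec x a b) + f g)"

section \<open>Formal words\<close>

text \<open>\<open>Tld a\<close> is the letter of the disjoint copy corresponding to \<open>a\<close>.\<close>

datatype 'a oper = Ltr 'a | Tld 'a | Zer | One
  | Mul "'a oper" "'a oper" (infixl \<open>[*]\<close> 70)
  | Add "'a oper" "'a oper" (infixl \<open>[+]\<close> 65)

inductive_set opers :: "'a set \<Rightarrow> 'a oper set" for x :: "'a set" where
  "a \<in> x \<Longrightarrow> Ltr a \<in> opers x"
| "a \<in> x \<Longrightarrow> Tld a \<in> opers x"
| "Zer \<in> opers x"
| "One \<in> opers x"
| "p \<in> opers x \<Longrightarrow> q \<in> opers x \<Longrightarrow> p [*] q \<in> opers x"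
| "p \<in> opers x \<Longrightarrow> q \<in> opers x \<Longrightarrow> p [+] q \<in> opers x"

primrec word_eval :: "(bit, 'm) module \<Rightarrow> ('a \<Rightarrow> 'm) \<Rightarrow> ('a \<Rightarrow> 'm) \<Rightarrow> 'a oper \<Rightarrow> 'm" where
  "word_eval A X Y (Ltr a) = X a"
| "word_eval A X Y (Tld a) = Y a"
| "word_eval A X Y Zer = \<zero>\<^bsub>A\<^esub>"
| "word_eval A X Y One = \<one>\<^bsub>A\<^esub>"
| "word_eval A X Y (p [*] q) = word_eval A X Y p \<otimes>\<^bsub>A\<^esub> word_eval A X Y q"
| "word_eval A X Y (p [+] q) = word_eval A X Y p \<oplus>\<^bsub>A\<^esub> word_eval A X Y q"

section \<open>Boole-Weyl algebras\<close>

text \<open>The congruence on words generated by the axioms of a unital associative algebra over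
  the field with two elements and the Boole-Weyl relations. The quotient of \<open>opers x\<close> by it
  is the algebra given by these generators and relations. The scalar action needs no separate
  rules, being determined by \<open>0\<close>, \<open>1\<close> and \<open>p + p = 0\<close>.\<close>

inductive bw_cong :: "'a set \<Rightarrow> 'a oper \<Rightarrow> 'a oper \<Rightarrow> bool" for x :: "'a set" where
  bw_refl: "p \<in> opers x \<Longrightarrow> bw_cong x p p"
| bw_sym: "bw_cong x p q \<Longrightarrow> bw_cong x q p"
| bw_trans: "bw_cong x p q \<Longrightarrow> bw_cong x q r \<Longrightarrow> bw_cong x p r"
| bw_add: "bw_cong x p p' \<Longrightarrow> bw_cong x q q' \<Longrightarrow> bw_cong x (p [+] q) (p' [+] q')"
| bw_mul: "bw_cong x p p' \<Longrightarrow> bw_cong x q q' \<Longrightarrow> bw_cong x (p [*] q) (p' [*] q')"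
| bw_add_assoc: "p \<in> opers x \<Longrightarrow> q \<in> opers x \<Longrightarrow> r \<in> opers x \<Longrightarrow>
    bw_cong x ((p [+] q) [+] r) (p [+] (q [+] r))"
| bw_add_comm: "p \<in> opers x \<Longrightarrow> q \<in> opers x \<Longrightarrow> bw_cong x (p [+] q) (q [+] p)"
| bw_add_zero: "p \<in> opers x \<Longrightarrow> bw_cong x (p [+] Zer) p"
| bw_add_self: "p \<in> opers x \<Longrightarrow> bw_cong x (p [+] p) Zer"
| bw_mul_assoc: "p \<in> opers x \<Longrightarrow> q \<in> opers x \<Longrightarrow> r \<in> opers x \<Longrightarrow>
    bw_cong x ((p [*] q) [*] r) (p [*] (q [*] r))"
| bw_one_left: "p \<in> opers x \<Longrightarrow> bw_cong x (One [*] p) p"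
| bw_one_right: "p \<in> opers x \<Longrightarrow> bw_cong x (p [*] One) p"
| bw_distrib_left: "p \<in> opers x \<Longrightarrow> q \<in> opers x \<Longrightarrow> r \<in> opers x \<Longrightarrow>
    bw_cong x (p [*] (q [+] r)) (p [*] q [+] p [*] r)"
| bw_distrib_right: "p \<in> opers x \<Longrightarrow> q \<in> opers x \<Longrightarrow> r \<in> opers x \<Longrightarrow>
    bw_cong x ((p [+] q) [*] r) (p [*] r [+] q [*] r)"
| bw_x_idem: "a \<in> x \<Longrightarrow> bw_cong x (Ltr a [*] Ltr a) (Ltr a)"
| bw_y_square: "a \<in> x \<Longrightarrow> bw_cong x (Tld a [*] Tld a) Zer"
| bw_y_x: "a \<in> x \<Longrightarrow> bw_cong x (Tld a [*] Ltr a) (Ltr a [*] Tld a [+] Tld a [+] One)"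
| bw_x_comm: "a \<in> x \<Longrightarrow> b \<in> x \<Longrightarrow> bw_cong x (Ltr a [*] Ltr b) (Ltr b [*] Ltr a)"
| bw_y_comm: "a \<in> x \<Longrightarrow> b \<in> x \<Longrightarrow> bw_cong x (Tld a [*] Tld b) (Tld b [*] Tld a)"
| bw_y_x_comm: "a \<in> x \<Longrightarrow> b \<in> x \<Longrightarrow> a \<noteq> b \<Longrightarrow>
    bw_cong x (Tld a [*] Ltr b) (Ltr b [*] Tld a)"

text \<open>\<open>A\<close> is presented by the generators \<open>X a\<close>, \<open>Y a\<close> for \<open>a \<in> x\<close> and the Boole-Weyl
  relations: the generators generate, and exactly the consequences of the relations hold.\<close>

definition boole_weyl ::
  "'a set \<Rightarrow> (bit, 'm) module \<Rightarrow> ('a \<Rightarrow> 'm) \<Rightarrow> ('a \<Rightarrow> 'm) \<Rightarrow> bool" where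
  "boole_weyl x A X Y \<longleftrightarrow> finite x \<and> z2_algebra A \<and>
     X \<in> x \<rightarrow> carrier A \<and> Y \<in> x \<rightarrow> carrier A \<and>
     word_eval A X Y ` opers x = carrier A \<and>
     (\<forall>p\<in>opers x. \<forall>q\<in>opers x. word_eval A X Y p = word_eval A X Y q \<longleftrightarrow> bw_cong x p q)"

section \<open>Functors on finite sets and bijections\<close>

text \<open>Objects are the finite sets of elements of an arbitrary type; morphisms are extensional
  bijections.\<close>

definition bijs :: "'a set \<Rightarrow> 'a set \<Rightarrow> ('a \<Rightarrow> 'a) set" where
  "bijs x y = {\<sigma> \<in> extensional x. bij_betw \<sigma> x y}"

record ('a, 'm) bw_functor_data =
  obj :: "'a set \<Rightarrow> (bit, 'm) module"
  mor :: "'a set \<Rightarrow> 'a set \<Rightarrow> ('a \<Rightarrow> 'a) \<Rightarrow> 'm \<Rightarrow> 'm"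
  genx :: "'a set \<Rightarrow> 'a \<Rightarrow> 'm"
  geny :: "'a set \<Rightarrow> 'a \<Rightarrow> 'm"

definition boole_weyl_functor :: "('a, 'm) bw_functor_data \<Rightarrow> bool" where
  "boole_weyl_functor F \<longleftrightarrow>
     (\<forall>x. finite x \<longrightarrow> boole_weyl x (obj F x) (genx F x) (geny F x)) \<and>
     (\<forall>x y \<sigma>. finite x \<longrightarrow> finite y \<longrightarrow> \<sigma> \<in> bijs x y \<longrightarrow>
        mor F x y \<sigma> \<in> z2_alg_hom (obj F x) (obj F y)) \<and>
     (\<forall>x. finite x \<longrightarrow> (\<forall>u\<in>carrier (obj F x). mor F x x (\<lambda>a\<in>x. a) u = u)) \<and>
     (\<forall>x y z \<sigma> \<tau>. finite x \<longrightarrow> finite y \<longrightarrow> finite z \<longrightarrow> \<sigma> \<in> bijs x y \<longrightarrow> \<tau> \<in> bijs y z \<longrightarrow>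
        (\<forall>u\<in>carrier (obj F x).
           mor F x z (compose x \<tau> \<sigma>) u = mor F y z \<tau> (mor F x y \<sigma> u)))"

definition naturally_isomorphic ::
  "('a, 'm) bw_functor_data \<Rightarrow> ('a, 'n) bw_functor_data \<Rightarrow> bool" where
  "naturally_isomorphic F G \<longleftrightarrow>
     (\<exists>\<eta>. (\<forall>x. finite x \<longrightarrow> \<eta> x \<in> z2_alg_iso (obj F x) (obj G x)) \<and>
          (\<forall>x y \<sigma>. finite x \<longrightarrow> finite y \<longrightarrow> \<sigma> \<in> bijs x y \<longrightarrow>
             (\<forall>u\<in>carrier (obj F x). \<eta> y (mor F x y \<sigma> u) = mor G x y \<sigma> (\<eta> x u))))"

section \<open>The functor of endomorphisms\<close>

definition push :: "'a set \<Rightarrow> 'a set \<Rightarrow> ('a \<Rightarrow> 'a) \<Rightarrow> (('a \<Rightarrow> bit) \<Rightarrow> bit) \<Rightarrow> (('a \<Rightarrow> bit) \<Rightarrow> bit)" where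
  "push x y \<sigma> f = (\<lambda>g\<in>cube y. f (compose x g \<sigma>))"

definition End_functor :: "('a, (('a \<Rightarrow> bit) \<Rightarrow> bit) \<Rightarrow> (('a \<Rightarrow> bit) \<Rightarrow> bit)) bw_functor_data" where
  "End_functor =
    \<lparr>obj = (\<lambda>x. End_algebra (bool_functions x)),
     mor = (\<lambda>x y \<sigma> T. \<lambda>f\<in>carrier (bool_functions y).
       push x y \<sigma> (T (inv_into (carrier (bool_functions x)) (push x y \<sigma>) f))),
     genx = coord_mult,
     geny = bool_deriv\<rparr>"

section \<open>The functor of operators\<close>

definition valuation :: "'a set \<Rightarrow> 'a oper \<Rightarrow> (('a \<Rightarrow> bit) \<Rightarrow> bit) \<Rightarrow> (('a \<Rightarrow> bit) \<Rightarrow> bit)" where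
  "valuation x = word_eval (End_algebra (bool_functions x)) (coord_mult x) (bool_deriv x)"

definition oper_rel :: "'a set \<Rightarrow> 'a oper rel" where
  "oper_rel x = {(p, q). p \<in> opers x \<and> q \<in> opers x \<and> valuation x p = valuation x q}"

text \<open>Since \<open>oper_rel x\<close> is compatible with the operations, the unions below are single
  equivalence classes.\<close>

definition oper_quot :: "'a set \<Rightarrow> (bit, 'a oper set) module" where
  "oper_quot x =
    \<lparr>carrier = opers x // oper_rel x,
     mult = (\<lambda>P Q. \<Union>p\<in>P. \<Union>q\<in>Q. oper_rel x `` {p [*] q}),
     one = oper_rel x `` {One},
     zero = oper_rel x `` {Zer},
     add = (\<lambda>P Q. \<Union>p\<in>P. \<Union>q\<in>Q. oper_rel x `` {p [+] q}),
     smult = (\<lambda>c P. if c = 0 then oper_rel x `` {Zer} else P)\<rparr>"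

definition oper_functor :: "('a, 'a oper set) bw_functor_data" where
  "oper_functor =
    \<lparr>obj = oper_quot,
     mor = (\<lambda>x y \<sigma> P. \<Union>p\<in>P. oper_rel y `` {map_oper \<sigma> p}),
     genx = (\<lambda>x a. oper_rel x `` {Ltr a}),
     geny = (\<lambda>x a. oper_rel x `` {Tld a})\<rparr>"

end

theory Submission
  imports Defs
begin

text \<open>
  The isomorphism sends the class of a word to its valuation. Since the equivalence of words is
  equality of valuations, this is injective by definition. What has to be shown is that the
  valuation reaches every endomorphism, and that two words with equal valuations are already
  congruent by the Boole-Weyl relations; the latter says that both algebras are presented by
  these relations and not merely satisfy them.

  Both follow from matrix units that exist in every ring \<open>A\<close> of characteristic two with the
  Boole-Weyl relations. Put \<open>s\<^sub>a = y\<^sub>a + 1\<close>. The relations say that \<open>x\<^sub>a\<^sup>2 = x\<^sub>a\<close>,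
  \<open>s\<^sub>a\<^sup>2 = 1\<close> and \<open>s\<^sub>a x\<^sub>a = (x\<^sub>a + 1) s\<^sub>a\<close>, that is,
  \<open>x\<^sub>a\<close> is an idempotent and \<open>s\<^sub>a\<close> is an involution that exchanges it with its complement. Hence
  \<open>e\<^sub>i\<^sub>j = (x\<^sub>a + i + 1) s\<^sub>a\<^sup>i\<^sup>+\<^sup>j\<close> with \<open>i, j \<in> {0, 1}\<close> are two-by-two matrix units, and letters with
  different indices commute. The product over \<open>a \<in> x\<close> of these elements gives \<open>E\<^sub>u\<^sub>v\<close> for points
  \<open>u, v\<close> of the cube. In the algebra of endomorphisms, \<open>E\<^sub>u\<^sub>v\<close> maps \<open>h\<close> to \<open>h(v)\<close> times the
  indicator of \<open>u\<close>.

  For a Boolean function \<open>f\<close> let \<open>\<Phi>\<^sub>v(f)\<close> be the sum of \<open>f(u) E\<^sub>u\<^sub>v\<close> over all \<open>u\<close>; this is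
  \<open>rank_one\<close> below. Left multiplication by a letter turns \<open>\<Phi>\<^sub>v(f)\<close> into \<open>\<Phi>\<^sub>v\<close> of the function
  obtained by applying the corresponding operator to \<open>f\<close>, so that \<open>p \<Phi>\<^sub>v(f) = \<Phi>\<^sub>v(p f)\<close> for
  every word \<open>p\<close>, where \<open>p f\<close> on the right is the valuation of \<open>p\<close> applied to \<open>f\<close> (lemma
  \<open>word_eval_rank_one\<close>). As \<open>1\<close> is the sum of the \<open>E\<^sub>v\<^sub>v\<close>, an element of \<open>A\<close> is determined by its
  products with all \<open>\<Phi>\<^sub>v(f)\<close> (lemma \<open>rank_one_separates\<close>). Therefore words with the same valuation
  have the same value in \<open>A\<close>. For \<open>A\<close> the algebra presented by the relations, this is the
  completeness of the relations (theorem \<open>valuation_eq_iff_bw_cong\<close>); for \<open>A\<close> the algebra of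
  endomorphisms, the operators \<open>\<Phi>\<^sub>v(f)\<close> are all maps of rank at most one, and their sums are all
  endomorphisms (lemma \<open>valuation_surj\<close>).

  Naturality then is a general fact: algebras presented by the same generators and relations are
  isomorphic by exactly one map that respects the generators, so functors whose morphisms permute
  the generators in the same way are naturally isomorphic
  (theorem \<open>naturally_isomorphic_if_generators_natural\<close>).
\<close>

section \<open>Modules over the field with two elements\<close>

text \<open>Sums and products of bits are to be simplified by the laws of a field; the default rules
  turn them into exclusive disjunctions and conjunctions, to which these laws do not apply.\<close>

declare add_bit_eq_xor [simp del] mult_bit_eq_and [simp del]

lemma bit_add_self [simp]: "(a::bit) + a = 0"
  by (cases a) simp_all

lemma bit_mult_self [simp]: "(a::bit) * a = a"
  by (cases a) simp_all

lemma F2_simps [simp]: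
  "carrier F2 = UNIV" "mult F2 = (*)" "one F2 = 1" "zero F2 = 0" "add F2 = (+)"
  by (simp_all add: F2_def)

lemma cring_F2: "cring F2"
proof (rule cringI)
  show "abelian_group F2"
  proof (rule abelian_groupI)
    fix u :: bit
    assume "u \<in> carrier F2"
    show "\<exists>v\<in>carrier F2. v \<oplus>\<^bsub>F2\<^esub> u = \<zero>\<^bsub>F2\<^esub>"
      by (rule bexI[of _ u]) simp_all
  qed (simp_all add: ac_simps)
  show "comm_monoid F2"
    by (rule comm_monoidI) (simp_all add: ac_simps)
qed (simp add: distrib_right)

lemma z2_algebraD:
  assumes "z2_algebra A"
  shows "module F2 A" "ring A"
  using assms unfolding z2_algebra_def by (rule conjunct1, rule conjunct1[OF conjunct2])

locale z2_module = module F2 M for M :: "(bit, 'm) module" (structure)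
begin

lemma smult_mem [simp, intro]: "u \<in> carrier M \<Longrightarrow> c \<odot> u \<in> carrier M"
  by (simp add: smult_closed)

lemma smult_zero_left [simp]: "u \<in> carrier M \<Longrightarrow> 0 \<odot> u = \<zero>"
  using smult_l_null by simp

lemma smult_one_left [simp]: "u \<in> carrier M \<Longrightarrow> 1 \<odot> u = u"
  using smult_one by simp

lemma add_self [simp]:
  assumes "u \<in> carrier M"
  shows "u \<oplus> u = \<zero>"
proof -
  have "u \<oplus> u = ((1::bit) + 1) \<odot> u"
    using smult_l_distr[of 1 1 u] assms by simp
  then show ?thesis
    using assms by simp
qed

end

lemma z2_algebra_End_algebra:
  assumes "module F2 M"
  shows "z2_algebra (End_algebra M)"
proof -
  interpret z2_module M using assms by (simp add: z2_module_def)
  let ?E = "End_algebra M"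
  note [simp] = End_algebra_def PiE_iff extensional_def compose_def restrict_def fun_eq_iff
  have ab: "abelian_group ?E"
  proof (rule abelian_groupI)
    fix S T assume "S \<in> carrier ?E" "T \<in> carrier ?E"
    then show "S \<oplus>\<^bsub>?E\<^esub> T \<in> carrier ?E"
      by (auto simp: smult_r_distr M.add.m_ac)
  next
    fix S assume "S \<in> carrier ?E"
    then show "\<exists>T\<in>carrier ?E. T \<oplus>\<^bsub>?E\<^esub> S = \<zero>\<^bsub>?E\<^esub>"
      by (intro bexI[of _ S]) auto
  qed (auto simp: M.add.m_ac)
  have "monoid ?E"
    by (rule monoidI) auto
  then have "ring ?E"
    using ab by (intro ringI) auto
  moreover have "module F2 ?E"
  proof (rule moduleI[OF cring_F2 ab])
    fix a b :: bit and S assume "S \<in> carrier ?E"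
    then show "(a \<oplus>\<^bsub>F2\<^esub> b) \<odot>\<^bsub>?E\<^esub> S = a \<odot>\<^bsub>?E\<^esub> S \<oplus>\<^bsub>?E\<^esub> b \<odot>\<^bsub>?E\<^esub> S"
      using smult_l_distr by auto
  next
    fix a b :: bit and S assume "S \<in> carrier ?E"
    then show "(a \<otimes>\<^bsub>F2\<^esub> b) \<odot>\<^bsub>?E\<^esub> S = a \<odot>\<^bsub>?E\<^esub> (b \<odot>\<^bsub>?E\<^esub> S)"
      using smult_assoc1 by auto
  next
    fix a :: bit and S assume "S \<in> carrier ?E"
    then show "a \<odot>\<^bsub>?E\<^esub> S \<in> carrier ?E"
      using smult_assoc1[symmetric] by (auto simp: smult_r_distr mult.commute)
  qed (auto simp: smult_r_distr)
  ultimately show ?thesis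
    by (auto simp: z2_algebra_def)
qed

lemma cube_ext: "g \<in> cube x \<Longrightarrow> h \<in> cube x \<Longrightarrow> (\<And>a. a \<in> x \<Longrightarrow> g a = h a) \<Longrightarrow> g = h"
  by (auto simp: cube_def intro: PiE_ext)

lemma module_bool_functions: "module F2 (bool_functions x)"
proof -
  note [simp] = bool_functions_def PiE_iff extensional_def restrict_def fun_eq_iff
  have ab: "abelian_group (bool_functions x)"
  proof (rule abelian_groupI)
    fix f assume "f \<in> carrier (bool_functions x)"
    then show "\<exists>h\<in>carrier (bool_functions x). h \<oplus>\<^bsub>bool_functions x\<^esub> f = \<zero>\<^bsub>bool_functions x\<^esub>"
      by (intro bexI[of _ f]) auto
  qed (auto simp: ac_simps)
  show ?thesis
    by (rule moduleI[OF cring_F2 ab]) (auto simp: algebra_simps)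
qed

section \<open>Matrix units from the Boole-Weyl relations\<close>

locale boole_weyl_relations = ring A for A :: "(bit, 'b) module" (structure) +
  fixes x :: "'a set" and X Y :: "'a \<Rightarrow> 'b"
  assumes X_closed [simp, intro]: "a \<in> x \<Longrightarrow> X a \<in> carrier A"
    and Y_closed [simp, intro]: "a \<in> x \<Longrightarrow> Y a \<in> carrier A"
    and add_self [simp]: "u \<in> carrier A \<Longrightarrow> u \<oplus> u = \<zero>"
    and X_idem: "a \<in> x \<Longrightarrow> X a \<otimes> X a = X a"
    and Y_square: "a \<in> x \<Longrightarrow> Y a \<otimes> Y a = \<zero>"
    and Y_X: "a \<in> x \<Longrightarrow> Y a \<otimes> X a = X a \<otimes> Y a \<oplus> Y a \<oplus> \<one>"
    and X_comm: "a \<in> x \<Longrightarrow> b \<in> x \<Longrightarrow> X a \<otimes> X b = X b \<otimes> X a"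
    and Y_comm: "a \<in> x \<Longrightarrow> b \<in> x \<Longrightarrow> Y a \<otimes> Y b = Y b \<otimes> Y a"
    and Y_X_comm: "a \<in> x \<Longrightarrow> b \<in> x \<Longrightarrow> a \<noteq> b \<Longrightarrow> Y a \<otimes> X b = X b \<otimes> Y a"
begin

lemma word_eval_closed [simp, intro]: "p \<in> opers x \<Longrightarrow> word_eval A X Y p \<in> carrier A"
  by (induction rule: opers.induct) auto

text \<open>The defining relations hold by assumption and the remaining rules of the congruence are
  consequences of the ring axioms and characteristic two.\<close>

lemma word_eval_bw_cong:
  assumes "bw_cong x p q"
  shows "p \<in> opers x \<and> q \<in> opers x \<and> word_eval A X Y p = word_eval A X Y q"
  using assms
proof induction
  case (bw_add_assoc p q r)
  then show ?case by (simp add: opers.intros a_assoc)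
next
  case (bw_y_x a)
  then show ?case by (auto intro: opers.intros simp: Y_X)
qed (auto intro!: opers.intros simp: m_assoc a_assoc a_comm l_distr r_distr X_idem Y_square
    intro: X_comm Y_comm Y_X_comm)

lemma add_self_left [simp]: "u \<in> carrier A \<Longrightarrow> v \<in> carrier A \<Longrightarrow> u \<oplus> (u \<oplus> v) = v"
  by (simp flip: a_assoc)

text \<open>In the algebra of endomorphisms this is the translation \<open>f \<mapsto> f (\<cdot> + e\<^sub>a)\<close>. In contrast to
  \<open>Y a\<close>, it is invertible.\<close>

definition shift :: "'a \<Rightarrow> 'b" where
  "shift a = Y a \<oplus> \<one>"

lemma shift_closed [simp, intro]: "a \<in> x \<Longrightarrow> shift a \<in> carrier A"
  by (simp add: shift_def)

lemma Y_eq_shift: "a \<in> x \<Longrightarrow> Y a = shift a \<oplus> \<one>"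
  by (simp add: shift_def a_assoc)

lemma shift_square: "a \<in> x \<Longrightarrow> shift a \<otimes> shift a = \<one>"
  by (simp add: shift_def l_distr r_distr Y_square a_assoc)

text \<open>In the algebra of endomorphisms this is the multiplication by the indicator of the half-cube
  of all \<open>g\<close> with \<open>g a = i\<close>; the translation exchanges the two half-cubes.\<close>

definition coord_is :: "'a \<Rightarrow> bit \<Rightarrow> 'b" where
  "coord_is a i = X a \<oplus> (if i = 1 then \<zero> else \<one>)"

lemma coord_is_closed [simp, intro]: "a \<in> x \<Longrightarrow> coord_is a i \<in> carrier A"
  by (simp add: coord_is_def)

lemma X_coord_is: "a \<in> x \<Longrightarrow> X a \<otimes> coord_is a i = (if i = 1 then coord_is a i else \<zero>)"
  by (cases i) (auto simp: coord_is_def r_distr X_idem)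

lemma shift_coord_is: "a \<in> x \<Longrightarrow> shift a \<otimes> coord_is a i = coord_is a (i + 1) \<otimes> shift a"
  by (cases i) (auto simp: coord_is_def shift_def l_distr r_distr Y_X a_ac)

definition matrix_unit :: "'a \<Rightarrow> bit \<Rightarrow> bit \<Rightarrow> 'b" where
  "matrix_unit a i j = coord_is a i \<otimes> (if i = j then \<one> else shift a)"

lemma matrix_unit_closed [simp, intro]: "a \<in> x \<Longrightarrow> matrix_unit a i j \<in> carrier A"
  by (simp add: matrix_unit_def)

lemma X_matrix_unit: "a \<in> x \<Longrightarrow> X a \<otimes> matrix_unit a i j = (if i = 1 then matrix_unit a i j else \<zero>)"
  by (auto simp: matrix_unit_def X_coord_is simp flip: m_assoc)

lemma shift_matrix_unit: "a \<in> x \<Longrightarrow> shift a \<otimes> matrix_unit a i j = matrix_unit a (i + 1) j"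
  by (cases i; cases j)
    (auto simp: matrix_unit_def shift_coord_is m_assoc shift_square simp flip: m_assoc[of "shift a" "coord_is a _"])

lemma matrix_unit_diag_sum: "a \<in> x \<Longrightarrow> matrix_unit a 0 0 \<oplus> matrix_unit a 1 1 = \<one>"
  by (auto simp: matrix_unit_def coord_is_def a_ac)

lemma comm_matrix_unit:
  assumes "c \<in> carrier A" "b \<in> x" "c \<otimes> X b = X b \<otimes> c" "c \<otimes> Y b = Y b \<otimes> c"
  shows "c \<otimes> matrix_unit b i j = matrix_unit b i j \<otimes> c"
proof -
  have "c \<otimes> coord_is b i = coord_is b i \<otimes> c"
    using assms by (auto simp: coord_is_def l_distr r_distr)
  moreover have "c \<otimes> shift b = shift b \<otimes> c"
    using assms by (auto simp: shift_def l_distr r_distr)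
  ultimately have "(c \<otimes> coord_is b i) \<otimes> (if i = j then \<one> else shift b) =
     coord_is b i \<otimes> ((if i = j then \<one> else shift b) \<otimes> c)"
    using assms by (simp add: m_assoc)
  then show ?thesis
    using assms by (simp add: matrix_unit_def m_assoc)
qed

lemma X_matrix_unit_comm: "a \<in> x \<Longrightarrow> b \<in> x \<Longrightarrow> a \<noteq> b \<Longrightarrow> X a \<otimes> matrix_unit b i j = matrix_unit b i j \<otimes> X a"
  by (intro comm_matrix_unit) (auto simp: X_comm Y_X_comm)

lemma shift_matrix_unit_comm:
  "a \<in> x \<Longrightarrow> b \<in> x \<Longrightarrow> a \<noteq> b \<Longrightarrow> shift a \<otimes> matrix_unit b i j = matrix_unit b i j \<otimes> shift a"
  by (intro comm_matrix_unit) (auto simp: Y_comm Y_X_comm shift_def l_distr r_distr)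

text \<open>\<open>rank_one v as g f\<close> is the sum of \<open>f u E\<^sub>u\<^sub>v\<close> over all \<open>u\<close> that agree with \<open>g\<close> outside of
  \<open>as\<close>, where \<open>E\<^sub>u\<^sub>v\<close> is the product of the \<open>matrix_unit a (u a) (v a)\<close> in the order of \<open>as\<close>. Summing
  over one coordinate at a time makes each property below an induction on \<open>as\<close> and fixes an order
  for the product in the noncommutative ring. At the end of the recursion \<open>g\<close> has become \<open>u\<close>; where
  \<open>as\<close> lists all of \<open>x\<close> below, \<open>g\<close> starts as the constant \<open>undefined\<close>, which makes \<open>u\<close> an
  extensional function, i.e. a point of the cube.\<close>

primrec rank_one :: "('a \<Rightarrow> bit) \<Rightarrow> 'a list \<Rightarrow> ('a \<Rightarrow> bit) \<Rightarrow> (('a \<Rightarrow> bit) \<Rightarrow> bit) \<Rightarrow> 'b" where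
  "rank_one v [] g f = (if f g = 1 then \<one> else \<zero>)"
| "rank_one v (a # as) g f =
     matrix_unit a 0 (v a) \<otimes> rank_one v as (g(a := 0)) f \<oplus>
     matrix_unit a 1 (v a) \<otimes> rank_one v as (g(a := 1)) f"

lemma rank_one_closed [simp, intro]: "set as \<subseteq> x \<Longrightarrow> rank_one v as g f \<in> carrier A"
  by (induction as arbitrary: g) auto

text \<open>The functions at which \<open>f\<close> is evaluated are those of the form
  \<open>override_on g k (set as)\<close>. This makes it possible to move a change of a coordinate outside of
  \<open>as\<close> from the base point to the function.\<close>

lemma rank_one_cong:
  assumes "distinct as" "\<And>b. b \<in> set as \<Longrightarrow> v b = v' b"
    "\<And>k. f (override_on g k (set as)) = f' (override_on g' k (set as))"
  shows "rank_one v as g f = rank_one v' as g' f'"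
  using assms
proof (induction as arbitrary: g g')
  case Nil
  then show ?case by simp
next
  case (Cons a as)
  have "rank_one v as (g(a := i)) f = rank_one v' as (g'(a := i)) f'" for i
  proof (rule Cons.IH)
    fix k
    have "override_on (h(a := i)) k (set as) = override_on h (k(a := i)) (set (a # as))" for h
      using Cons.prems(1) by (auto simp: override_on_def)
    then show "f (override_on (g(a := i)) k (set as)) = f' (override_on (g'(a := i)) k (set as))"
      using Cons.prems(3) by (simp only:)
  qed (use Cons.prems in auto)
  then show ?case using Cons.prems(2) by simp
qed

lemma rank_one_zero [simp]: "set as \<subseteq> x \<Longrightarrow> rank_one v as g (\<lambda>h. 0) = \<zero>"
  by (induction as arbitrary: g) auto

lemma rank_one_add:
  "set as \<subseteq> x \<Longrightarrow> rank_one v as g (\<lambda>h. f h + f' h) = rank_one v as g f \<oplus> rank_one v as g f'"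
proof (induction as arbitrary: g)
  case Nil
  then show ?case by (cases "f g"; cases "f' g") auto
next
  case (Cons a as)
  then show ?case by (simp add: r_distr a_ac)
qed

text \<open>The letter commutes with the matrix units of the other coordinates until it meets that of
  its own, where multiplication by \<open>X a\<close> keeps the row \<open>1\<close> and deletes the row \<open>0\<close>.\<close>

lemma X_rank_one:
  assumes "distinct as" "set as \<subseteq> x" "a \<in> set as"
  shows "X a \<otimes> rank_one v as g f = rank_one v as g (\<lambda>h. h a * f h)"
  using assms
proof (induction as arbitrary: g)
  case Nil
  then show ?case by simp
next
  case (Cons b as)
  show ?case
  proof (cases "a = b")
    case True
    have "rank_one v as (g(a := 0)) (\<lambda>h. h a * f h) = rank_one v as g (\<lambda>h. 0)"
      using Cons.prems True by (intro rank_one_cong) auto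
    moreover have "rank_one v as (g(a := 1)) (\<lambda>h. h a * f h) = rank_one v as (g(a := 1)) f"
      using Cons.prems True by (intro rank_one_cong) auto
    ultimately show ?thesis
      using Cons.prems True by (simp add: r_distr X_matrix_unit flip: m_assoc)
  next
    case False
    have "X a \<otimes> (matrix_unit b i j \<otimes> rank_one v as g f) =
      matrix_unit b i j \<otimes> (X a \<otimes> rank_one v as g f)" for i j g
      using Cons.prems False X_matrix_unit_comm[of a b i j] by (auto simp: subset_eq simp flip: m_assoc)
    moreover have "a \<in> x"
      using Cons.prems by auto
    ultimately show ?thesis
      using Cons False by (auto simp: r_distr fun_upd_def)
  qed
qed

text \<open>Multiplication by the translation exchanges the two rows of the matrix units of the
  coordinate \<open>a\<close>.\<close>

lemma shift_rank_one:
  assumes "distinct as" "set as \<subseteq> x" "a \<in> set as"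
  shows "shift a \<otimes> rank_one v as g f = rank_one v as g (\<lambda>h. f (h(a := h a + 1)))"
  using assms
proof (induction as arbitrary: g)
  case Nil
  then show ?case by simp
next
  case (Cons b as)
  show ?case
  proof (cases "a = b")
    case True
    define F where "F = (\<lambda>h. f (h(a := h a + 1)))"
    have "rank_one v as (g(a := i)) F = rank_one v as (g(a := i + 1)) f" for i
    proof (rule rank_one_cong)
      fix k
      have "(override_on (g(a := i)) k (set as))(a := override_on (g(a := i)) k (set as) a + 1) =
        override_on (g(a := i + 1)) k (set as)"
        using Cons.prems True by (auto simp: override_on_def)
      then show "F (override_on (g(a := i)) k (set as)) = f (override_on (g(a := i + 1)) k (set as))"
        by (simp only: F_def)
    qed (use Cons.prems in auto)
    then show ?thesis
      unfolding F_def[symmetric]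
      using Cons.prems True by (simp add: r_distr shift_matrix_unit a_comm flip: m_assoc)
  next
    case False
    have "shift a \<otimes> (matrix_unit b i j \<otimes> rank_one v as g f) =
      matrix_unit b i j \<otimes> (shift a \<otimes> rank_one v as g f)" for i j g
      using Cons.prems False shift_matrix_unit_comm[of a b i j] by (auto simp: subset_eq simp flip: m_assoc)
    moreover have "a \<in> x"
      using Cons.prems by auto
    ultimately show ?thesis
      using Cons False by (auto simp: r_distr fun_upd_def)
  qed
qed

lemma Y_rank_one:
  assumes "distinct as" "set as \<subseteq> x" "a \<in> set as"
  shows "Y a \<otimes> rank_one v as g f = rank_one v as g (\<lambda>h. f (h(a := h a + 1)) + f h)"
proof -
  have "a \<in> x" using assms by auto
  then show ?thesis
    using assms by (simp add: Y_eq_shift l_distr shift_rank_one rank_one_add)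
qed

text \<open>Induction on the coordinates: since \<open>1 = e\<^sub>0\<^sub>0 + e\<^sub>1\<^sub>1\<close>, it is enough to compare the products
  of \<open>p\<close> and \<open>q\<close> with both diagonal matrix units of the first coordinate, and these products are
  compared by the induction hypothesis.\<close>

lemma rank_one_separates:
  assumes "distinct as" "set as \<subseteq> x" "p \<in> carrier A" "q \<in> carrier A"
    "\<And>v f. p \<otimes> rank_one v as g f = q \<otimes> rank_one v as g f"
  shows "p = q"
  using assms
proof (induction as arbitrary: p q)
  case Nil
  then show ?case using Nil(5)[of undefined "\<lambda>_. 1"] by simp
next
  case (Cons a as)
  have a: "a \<in> x" using Cons.prems by simp
  have diag: "p \<otimes> matrix_unit a i i = q \<otimes> matrix_unit a i i" for i
  proof (rule Cons.IH)
    fix v f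
    \<comment> \<open>The column \<open>i\<close> is chosen through \<open>v'\<close>; the row \<open>i\<close> by a function vanishing elsewhere. This function
      also undoes the change of the base point at \<open>a\<close>, since the induction hypothesis has \<open>g\<close> fixed.\<close>
    define v' where "v' = v(a := i)"
    define f' where "f' = (\<lambda>h. if h a = i then f (h(a := g a)) else (0::bit))"
    have v': "v' a = i" "\<And>b. b \<in> set as \<Longrightarrow> v' b = v b"
      using Cons.prems by (auto simp: v'_def)
    have "rank_one v' as (g(a := j)) f' = (if j = i then rank_one v as g f else rank_one v as g (\<lambda>_. 0))" for j
    proof (cases "j = i")
      case True
      have *: "(override_on (g(a := i)) k (set as))(a := g a) = override_on g k (set as)" for k
        using Cons.prems by (auto simp: override_on_def)
      show ?thesis
        unfolding if_P[OF True] using Cons.prems True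
        by (intro rank_one_cong) (auto simp: f'_def v' *)
    next
      case False
      show ?thesis
        unfolding if_not_P[OF False] using Cons.prems False
        by (intro rank_one_cong) (auto simp: f'_def v')
    qed
    then have "rank_one v' (a # as) g f' = matrix_unit a i i \<otimes> rank_one v as g f"
      using Cons.prems by (cases i) (auto simp: v')
    then show "p \<otimes> matrix_unit a i i \<otimes> rank_one v as g f = q \<otimes> matrix_unit a i i \<otimes> rank_one v as g f"
      using Cons.prems(5)[of v' f'] Cons.prems(1-4) by (simp add: m_assoc del: rank_one.simps)
  qed (use Cons.prems in auto)
  have "p = p \<otimes> (matrix_unit a 0 0 \<oplus> matrix_unit a 1 1)"
    using Cons.prems a by (simp add: matrix_unit_diag_sum)
  also have "\<dots> = q \<otimes> (matrix_unit a 0 0 \<oplus> matrix_unit a 1 1)"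
    using Cons.prems a diag by (simp add: r_distr)
  also have "\<dots> = q"
    using Cons.prems a by (simp add: matrix_unit_diag_sum)
  finally show ?case .
qed

end

section \<open>Multiplication and differentiation of Boolean functions\<close>

lemma mem_cube_iff: "g \<in> cube x \<longleftrightarrow> g \<in> extensional x"
  by (auto simp: cube_def PiE_iff)

lemma upd_mem_cube [simp]: "g \<in> cube x \<Longrightarrow> a \<in> x \<Longrightarrow> g(a := i) \<in> cube x"
  by (auto simp: mem_cube_iff extensional_def)

lemma mem_bool_functions_iff: "f \<in> carrier (bool_functions x) \<longleftrightarrow> f \<in> extensional (cube x)"
  by (simp add: bool_functions_def PiE_iff)

lemma restrict_mem_bool_functions [simp]: "(\<lambda>g\<in>cube x. f g) \<in> carrier (bool_functions x)"
  by (simp add: mem_bool_functions_iff)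

lemma bool_functions_eqI:
  "f \<in> carrier (bool_functions x) \<Longrightarrow> h \<in> carrier (bool_functions x) \<Longrightarrow>
   (\<And>g. g \<in> cube x \<Longrightarrow> f g = h g) \<Longrightarrow> f = h"
  unfolding mem_bool_functions_iff by (rule extensionalityI)

abbreviation cube_End :: "'a set \<Rightarrow> (bit, (('a \<Rightarrow> bit) \<Rightarrow> bit) \<Rightarrow> (('a \<Rightarrow> bit) \<Rightarrow> bit)) module" where
  "cube_End x \<equiv> End_algebra (bool_functions x)"

lemma End_mem:
  "S \<in> carrier (End_algebra M) \<Longrightarrow> u \<in> carrier M \<Longrightarrow> S u \<in> carrier M"
  by (simp add: End_algebra_def PiE_iff)

lemma End_algebra_eqI:
  assumes "S \<in> carrier (End_algebra M)" "T \<in> carrier (End_algebra M)"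
    "\<And>u. u \<in> carrier M \<Longrightarrow> S u = T u"
  shows "S = T"
proof (rule extensionalityI)
  show "S \<in> extensional (carrier M)" "T \<in> extensional (carrier M)"
    using assms(1,2) by (simp_all add: End_algebra_def PiE_iff)
qed (rule assms(3))

lemma End_mult_apply [simp]: "u \<in> carrier M \<Longrightarrow> (S \<otimes>\<^bsub>End_algebra M\<^esub> T) u = S (T u)"
  by (simp add: End_algebra_def compose_def)

lemma End_one_apply [simp]: "u \<in> carrier M \<Longrightarrow> \<one>\<^bsub>End_algebra M\<^esub> u = u"
  by (simp add: End_algebra_def)

lemma cube_End_add_apply [simp]:
  "f \<in> carrier (bool_functions x) \<Longrightarrow> g \<in> cube x \<Longrightarrow>
   (S \<oplus>\<^bsub>cube_End x\<^esub> T) f g = S f g + T f g"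
  by (simp add: End_algebra_def bool_functions_def)

lemma cube_End_zero_apply [simp]:
  "f \<in> carrier (bool_functions x) \<Longrightarrow> g \<in> cube x \<Longrightarrow> \<zero>\<^bsub>cube_End x\<^esub> f g = 0"
  by (simp add: End_algebra_def bool_functions_def)

lemma coord_mult_apply:
  "f \<in> carrier (bool_functions x) \<Longrightarrow> coord_mult x a f = (\<lambda>g\<in>cube x. g a * f g)"
  by (simp add: coord_mult_def coord_def bool_functions_def cong: restrict_cong)

lemma bool_deriv_apply:
  assumes "f \<in> carrier (bool_functions x)" "a \<in> x"
  shows "bool_deriv x a f = (\<lambda>g\<in>cube x. f (g(a := g a + 1)) + f g)"
proof -
  have "(\<lambda>b\<in>x. g b + unit_vec x a b) = g(a := g a + 1)" if "g \<in> cube x" for g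
    using that assms by (auto simp: mem_cube_iff extensional_def unit_vec_def)
  then show ?thesis
    using assms by (simp add: bool_deriv_def cong: restrict_cong)
qed

lemma bool_functions_add_apply [simp]:
  "g \<in> cube x \<Longrightarrow> (f \<oplus>\<^bsub>bool_functions x\<^esub> h) g = f g + h g"
  by (simp add: bool_functions_def)

lemma bool_functions_smult_apply [simp]:
  "g \<in> cube x \<Longrightarrow> (c \<odot>\<^bsub>bool_functions x\<^esub> f) g = c * f g"
  by (simp add: bool_functions_def)

lemma bool_functions_zero_apply [simp]:
  "g \<in> cube x \<Longrightarrow> \<zero>\<^bsub>bool_functions x\<^esub> g = 0"
  by (simp add: bool_functions_def)

lemma cube_End_memI:
  assumes "T \<in> extensional (carrier (bool_functions x))"
    "\<And>f. f \<in> carrier (bool_functions x) \<Longrightarrow> T f \<in> carrier (bool_functions x)"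
    "\<And>f h g. f \<in> carrier (bool_functions x) \<Longrightarrow> h \<in> carrier (bool_functions x) \<Longrightarrow> g \<in> cube x \<Longrightarrow>
       T (f \<oplus>\<^bsub>bool_functions x\<^esub> h) g = T f g + T h g"
    "\<And>f c g. f \<in> carrier (bool_functions x) \<Longrightarrow> g \<in> cube x \<Longrightarrow>
       T (c \<odot>\<^bsub>bool_functions x\<^esub> f) g = c * T f g"
  shows "T \<in> carrier (cube_End x)"
proof -
  interpret z2_module "bool_functions x"
    using module_bool_functions by (simp add: z2_module_def)
  have "T (f \<oplus>\<^bsub>bool_functions x\<^esub> h) = T f \<oplus>\<^bsub>bool_functions x\<^esub> T h"
    if "f \<in> carrier (bool_functions x)" "h \<in> carrier (bool_functions x)" for f h
    using that assms by (intro bool_functions_eqI[of _ x]) simp_all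
  moreover have "T (c \<odot>\<^bsub>bool_functions x\<^esub> f) = c \<odot>\<^bsub>bool_functions x\<^esub> T f"
    if "f \<in> carrier (bool_functions x)" for f c
    using that assms by (intro bool_functions_eqI[of _ x]) simp_all
  ultimately show ?thesis
    using assms(1,2) by (simp add: End_algebra_def PiE_iff)
qed

lemma coord_mult_mem: "coord_mult x a \<in> carrier (cube_End x)"
proof -
  interpret z2_module "bool_functions x"
    using module_bool_functions by (simp add: z2_module_def)
  show ?thesis
    by (rule cube_End_memI)
      (simp_all add: coord_mult_apply distrib_left mult.left_commute, simp add: coord_mult_def)
qed

lemma bool_deriv_mem:
  assumes "a \<in> x"
  shows "bool_deriv x a \<in> carrier (cube_End x)"
proof -
  interpret z2_module "bool_functions x"
    using module_bool_functions by (simp add: z2_module_def)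
  show ?thesis
    using assms
    by (intro cube_End_memI)
      (simp_all add: bool_deriv_apply distrib_left ac_simps, simp add: bool_deriv_def)
qed

lemma boole_weyl_relations_End:
  "boole_weyl_relations (cube_End x) x (coord_mult x) (bool_deriv x)"
proof -
  interpret ring "cube_End x"
    by (rule z2_algebraD(2)[OF z2_algebra_End_algebra[OF module_bool_functions]])
  have eqI: "S = T" if "S \<in> carrier (cube_End x)" "T \<in> carrier (cube_End x)"
    "\<And>f g. f \<in> carrier (bool_functions x) \<Longrightarrow> g \<in> cube x \<Longrightarrow> S f g = T f g" for S T
  proof (rule End_algebra_eqI[OF that(1,2)])
    note ST = that
    show "S u = T u" if u: "u \<in> carrier (bool_functions x)" for u
      by (rule bool_functions_eqI[OF End_mem[OF ST(1) u] End_mem[OF ST(2) u] ST(3)[OF u]])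
  qed
  note [simp] = coord_mult_mem bool_deriv_mem coord_mult_apply bool_deriv_apply
  show ?thesis
  proof (intro boole_weyl_relations.intro boole_weyl_relations_axioms.intro)
    show "ring (cube_End x)" by (rule ring_axioms)
  next
    fix u assume "u \<in> carrier (cube_End x)"
    then show "u \<oplus>\<^bsub>cube_End x\<^esub> u = \<zero>\<^bsub>cube_End x\<^esub>"
      by (intro eqI) simp_all
  next
    fix a assume "a \<in> x"
    then show "coord_mult x a \<otimes>\<^bsub>cube_End x\<^esub> coord_mult x a = coord_mult x a"
      by (intro eqI) (simp_all flip: mult.assoc)
  next
    fix a assume "a \<in> x"
    then show "bool_deriv x a \<otimes>\<^bsub>cube_End x\<^esub> bool_deriv x a = \<zero>\<^bsub>cube_End x\<^esub>"
      by (intro eqI) (simp_all add: add.assoc add.commute)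
  next
    fix a assume "a \<in> x"
    then show "bool_deriv x a \<otimes>\<^bsub>cube_End x\<^esub> coord_mult x a =
      coord_mult x a \<otimes>\<^bsub>cube_End x\<^esub> bool_deriv x a \<oplus>\<^bsub>cube_End x\<^esub> bool_deriv x a \<oplus>\<^bsub>cube_End x\<^esub> \<one>\<^bsub>cube_End x\<^esub>"
      by (intro eqI) (simp_all add: distrib_left distrib_right ac_simps)
  next
    fix a b assume "a \<in> x" "b \<in> x"
    then show "coord_mult x a \<otimes>\<^bsub>cube_End x\<^esub> coord_mult x b = coord_mult x b \<otimes>\<^bsub>cube_End x\<^esub> coord_mult x a"
      by (intro eqI) (simp_all add: ac_simps)
  next
    fix a b assume "a \<in> x" "b \<in> x"
    then show "bool_deriv x a \<otimes>\<^bsub>cube_End x\<^esub> bool_deriv x b = bool_deriv x b \<otimes>\<^bsub>cube_End x\<^esub> bool_deriv x a"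
      by (cases "a = b") (auto intro!: eqI simp: ac_simps fun_upd_twist[of a b])
  next
    fix a b assume "a \<in> x" "b \<in> x" "a \<noteq> b"
    then show "bool_deriv x a \<otimes>\<^bsub>cube_End x\<^esub> coord_mult x b = coord_mult x b \<otimes>\<^bsub>cube_End x\<^esub> bool_deriv x a"
      by (intro eqI) (simp_all add: distrib_left)
  qed simp_all
qed

section \<open>Words act on rank-one elements through their valuation\<close>

context boole_weyl_relations
begin

text \<open>For fixed \<open>v\<close>, the map sending \<open>f\<close> to \<open>rank_one v as (\<lambda>_. undefined) f\<close> is additive, and words
  act on its image as they act on Boolean functions. Both sides are compatible with sums and
  products of words, so that only the letters have to be checked.\<close>

lemma word_eval_rank_one:
  assumes "distinct as" "set as = x" "p \<in> opers x" "f \<in> carrier (bool_functions x)"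
  shows "word_eval A X Y p \<otimes> rank_one v as (\<lambda>_. undefined) f =
    rank_one v as (\<lambda>_. undefined) (valuation x p f)"
proof -
  interpret E: boole_weyl_relations "cube_End x" x "coord_mult x" "bool_deriv x"
    by (rule boole_weyl_relations_End)
  have cube: "override_on (\<lambda>_. undefined) k (set as) \<in> cube x" for k
    using assms(2) by (auto simp: mem_cube_iff extensional_def override_on_def)
  have val: "valuation x q h \<in> carrier (bool_functions x)"
    if "q \<in> opers x" "h \<in> carrier (bool_functions x)" for q h
    using that by (simp add: valuation_def End_mem[of _ "bool_functions x"])
  show ?thesis
    using assms(3,4)
  proof (induction arbitrary: f)
    case (1 a)
    have "rank_one v as (\<lambda>_. undefined) (valuation x (Ltr a) f) =
      rank_one v as (\<lambda>_. undefined) (\<lambda>h. h a * f h)"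
      using 1 assms(1) by (intro rank_one_cong) (auto simp: valuation_def coord_mult_apply cube)
    then show ?case
      using 1 assms(1,2) by (simp add: X_rank_one)
  next
    case (2 a)
    have "rank_one v as (\<lambda>_. undefined) (valuation x (Tld a) f) =
      rank_one v as (\<lambda>_. undefined) (\<lambda>h. f (h(a := h a + 1)) + f h)"
      using 2 assms(1) by (intro rank_one_cong) (auto simp: valuation_def bool_deriv_apply cube)
    then show ?case
      using 2 assms(1,2) by (simp add: Y_rank_one)
  next
    case 3
    have "rank_one v as (\<lambda>_. undefined) (valuation x Zer f) = rank_one v as (\<lambda>_. undefined) (\<lambda>_. 0)"
      using 3 assms(1) by (intro rank_one_cong) (auto simp: valuation_def cube)
    then show ?case using assms(2) by simp
  next
    case 4
    then show ?case using assms(2) by (simp add: valuation_def)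
  next
    case (5 p q)
    then show ?case
      using assms(2) val[of q f] by (simp add: m_assoc) (simp add: valuation_def)
  next
    case (6 p q)
    have "rank_one v as (\<lambda>_. undefined) (valuation x (p [+] q) f) =
      rank_one v as (\<lambda>_. undefined) (\<lambda>h. valuation x p f h + valuation x q f h)"
      using 6 assms(1) by (intro rank_one_cong) (auto simp: valuation_def cube)
    then show ?case
      using 6 assms(2) by (simp add: l_distr rank_one_add)
  qed
qed

text \<open>Thus the algebra of endomorphisms satisfies no relations beyond those that hold in every
  ring of this kind.\<close>

theorem word_eval_eq_if_valuation_eq:
  assumes "finite x" "p \<in> opers x" "q \<in> opers x" "valuation x p = valuation x q"
  shows "word_eval A X Y p = word_eval A X Y q"
proof -
  obtain as where as: "distinct as" "set as = x"
    using finite_distinct_list[OF assms(1)] by blast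
  show ?thesis
  proof (rule rank_one_separates)
    fix v f
    have "override_on (\<lambda>_. undefined) k (set as) \<in> cube x" for k
      using as by (auto simp: mem_cube_iff extensional_def override_on_def)
    then have "rank_one v as (\<lambda>_. undefined) f = rank_one v as (\<lambda>_. undefined) (\<lambda>g\<in>cube x. f g)"
      using as by (intro rank_one_cong) auto
    then show "word_eval A X Y p \<otimes> rank_one v as (\<lambda>_. undefined) f =
      word_eval A X Y q \<otimes> rank_one v as (\<lambda>_. undefined) f"
      using as assms by (simp add: word_eval_rank_one)
  qed (use as assms in auto)
qed

lemma range_word_eval_intros:
  shows "\<zero> \<in> word_eval A X Y ` opers x" "\<one> \<in> word_eval A X Y ` opers x"
    "a \<in> x \<Longrightarrow> X a \<in> word_eval A X Y ` opers x" "a \<in> x \<Longrightarrow> Y a \<in> word_eval A X Y ` opers x"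
  using opers.intros(1-4)[THEN imageI[of _ _ "word_eval A X Y"]] by simp_all

lemma range_word_eval_add:
  assumes "u \<in> word_eval A X Y ` opers x" "w \<in> word_eval A X Y ` opers x"
  shows "u \<oplus> w \<in> word_eval A X Y ` opers x"
  using assms opers.intros(6)[THEN imageI[of _ _ "word_eval A X Y"]] by fastforce

lemma range_word_eval_mult:
  assumes "u \<in> word_eval A X Y ` opers x" "w \<in> word_eval A X Y ` opers x"
  shows "u \<otimes> w \<in> word_eval A X Y ` opers x"
  using assms opers.intros(5)[THEN imageI[of _ _ "word_eval A X Y"]] by fastforce

lemma rank_one_in_range: "set as \<subseteq> x \<Longrightarrow> rank_one v as g f \<in> word_eval A X Y ` opers x"
proof (induction as arbitrary: g)
  case Nil
  then show ?case by (simp add: range_word_eval_intros)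
next
  case (Cons a as)
  then have "matrix_unit a i j \<in> word_eval A X Y ` opers x" for i j
    by (simp add: matrix_unit_def coord_is_def shift_def range_word_eval_intros range_word_eval_add
        range_word_eval_mult del: r_zero r_one)
  then show ?case
    using Cons by (simp add: range_word_eval_add range_word_eval_mult)
qed

end

section \<open>Every endomorphism is the valuation of a word\<close>

text \<open>An endomorphism \<open>T\<close> is the sum, over all points \<open>v\<close> of the cube, of the operators
  \<open>h \<mapsto> h v T(\<delta>\<^sub>v)\<close> of rank at most one, where \<open>\<delta>\<^sub>v\<close> is the indicator of \<open>v\<close>. The proof
  removes these summands one by one: if \<open>T h\<close> depends only on the values of \<open>h\<close> on \<open>V\<close>, adding
  the summand for \<open>v \<in> V\<close> yields an operator depending only on the values on \<open>V - {v}\<close>.\<close>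

lemma valuation_surj:
  fixes x :: "'a set"
  assumes "finite x"
  shows "valuation x ` opers x = carrier (cube_End x)"
proof -
  interpret boole_weyl_relations "cube_End x" x "coord_mult x" "bool_deriv x"
    by (rule boole_weyl_relations_End)
  interpret B: z2_module "bool_functions x"
    using module_bool_functions by (simp add: z2_module_def)
  let ?B = "carrier (bool_functions x)" and ?W = "valuation x ` opers x"
  have W: "?W = word_eval (cube_End x) (coord_mult x) (bool_deriv x) ` opers x"
    by (simp add: valuation_def)
  obtain as where as: "distinct as" "set as = x"
    using finite_distinct_list[OF assms] by blast
  have matrix_unit: "matrix_unit a i j h g = (if g a = i then h (g(a := j)) else 0)"
    if "a \<in> x" "h \<in> ?B" "g \<in> cube x" for a i j h g
  proof -
    note mem = End_mem[of _ "bool_functions x"]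
    have shift: "shift a \<in> carrier (cube_End x)" "\<And>g. g \<in> cube x \<Longrightarrow> shift a h g = h (g(a := g a + 1))"
      using that by (auto simp: shift_def bool_deriv_apply add.assoc)
    have "coord_is a i u g = (if g a = i then u g else 0)" if "u \<in> ?B" for u
      using that \<open>g \<in> cube x\<close> by (cases i; cases "g a") (auto simp: coord_is_def coord_mult_apply)
    then show ?thesis
      using that shift mem[OF shift(1) that(2)] fun_upd_idem[of g a i]
      by (cases i; cases j; cases "g a") (auto simp: matrix_unit_def)
  qed
  have rank_one: "rank_one v as' g0 f h g = f (override_on g0 g (set as')) * h (override_on g v (set as'))"
    if "distinct as'" "set as' \<subseteq> x" "h \<in> ?B" "g \<in> cube x" for v as' g0 f h g
    using that
  proof (induction as' arbitrary: g g0)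
    case Nil
    then show ?case by (cases "f g0") auto
  next
    case (Cons a as')
    have "rank_one v as' g1 f h \<in> ?B" for g1
      by (rule End_mem[OF rank_one_closed]) (use Cons.prems in auto)
    then have "rank_one v (a # as') g0 f h g = rank_one v as' (g0(a := g a)) f h (g(a := v a))"
      using Cons.prems by (cases "g a") (auto simp: matrix_unit)
    also have "\<dots> = f (override_on (g0(a := g a)) (g(a := v a)) (set as')) *
        h (override_on (g(a := v a)) v (set as'))"
      by (rule Cons.IH[OF _ _ _ upd_mem_cube]) (use Cons.prems in simp_all)
    also have "override_on (g0(a := g a)) (g(a := v a)) (set as') = override_on g0 g (set (a # as'))"
      using Cons.prems by (auto simp: override_on_def)
    also have "override_on (g(a := v a)) v (set as') = override_on g v (set (a # as'))"
      using Cons.prems by (auto simp: override_on_def)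
    finally show ?case .
  qed
  \<comment> \<open>\<open>V\<close> contains the points on which \<open>T h\<close> may depend.\<close>
  have *: "T \<in> ?W" if "finite V" "V \<subseteq> cube x" "T \<in> carrier (cube_End x)"
    "\<And>h. h \<in> ?B \<Longrightarrow> (\<And>v. v \<in> V \<Longrightarrow> h v = 0) \<Longrightarrow> T h = \<zero>\<^bsub>bool_functions x\<^esub>" for V T
    using that
  proof (induction V arbitrary: T)
    case empty
    then have "T = \<zero>\<^bsub>cube_End x\<^esub>"
      by (intro End_algebra_eqI) (auto simp: End_algebra_def)
    then show ?case unfolding W by (simp add: range_word_eval_intros)
  next
    case (insert v V)
    \<comment> \<open>As \<open>h + h v d\<close> vanishes at \<open>v\<close>, adding the rank-one operator \<open>h \<mapsto> h v (T d)\<close> to \<open>T\<close>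
      removes the dependence on \<open>h v\<close>.\<close>
    define d where "d = (\<lambda>g\<in>cube x. if g = v then 1 else (0::bit))"
    have d: "d \<in> ?B" "\<And>g. g \<in> cube x \<Longrightarrow> d g = (if g = v then 1 else 0)"
      unfolding d_def by (rule restrict_mem_bool_functions) simp
    let ?R = "rank_one v as (\<lambda>_. undefined) (T d)"
    have v: "v \<in> cube x" using insert.prems by simp
    have Td: "T d \<in> ?B"
      by (rule End_mem[OF insert.prems(2) d(1)])
    have R: "?R \<in> carrier (cube_End x)" "?R h = h v \<odot>\<^bsub>bool_functions x\<^esub> T d" if "h \<in> ?B" for h
    proof -
      show "?R \<in> carrier (cube_End x)" using as by auto
      have "override_on (\<lambda>_. undefined) g x = g" "override_on g v x = v" if "g \<in> cube x" for g
        using that v by (auto simp: mem_cube_iff extensional_def override_on_def)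
      then show "?R h = h v \<odot>\<^bsub>bool_functions x\<^esub> T d"
        using that as Td
        by (intro bool_functions_eqI[of _ x] End_mem[OF \<open>?R \<in> carrier (cube_End x)\<close>])
          (simp_all add: rank_one mult.commute)
    qed
    have "T \<oplus>\<^bsub>cube_End x\<^esub> ?R \<in> ?W"
    proof (rule insert.IH)
      fix h assume h: "h \<in> ?B" "\<And>v. v \<in> V \<Longrightarrow> h v = 0"
      have "(T \<oplus>\<^bsub>cube_End x\<^esub> ?R) h = T h \<oplus>\<^bsub>bool_functions x\<^esub> h v \<odot>\<^bsub>bool_functions x\<^esub> T d"
        using h R(2) by (simp add: End_algebra_def)
      also have "\<dots> = T (h \<oplus>\<^bsub>bool_functions x\<^esub> h v \<odot>\<^bsub>bool_functions x\<^esub> d)"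
        using insert.prems(2) h(1) d(1) by (simp add: End_algebra_def)
      also have "\<dots> = \<zero>\<^bsub>bool_functions x\<^esub>"
      proof (rule insert.prems(3))
        show "(h \<oplus>\<^bsub>bool_functions x\<^esub> h v \<odot>\<^bsub>bool_functions x\<^esub> d) w = 0" if "w \<in> insert v V" for w
          using that h insert.prems(1) insert.hyps d(2) by auto
      qed (use h d(1) in simp)
      finally show "(T \<oplus>\<^bsub>cube_End x\<^esub> ?R) h = \<zero>\<^bsub>bool_functions x\<^esub>" .
    qed (use insert.prems R in auto)
    moreover have "?R \<in> ?W"
      unfolding W using as by (intro rank_one_in_range) simp
    ultimately have "(T \<oplus>\<^bsub>cube_End x\<^esub> ?R) \<oplus>\<^bsub>cube_End x\<^esub> ?R \<in> ?W"
      unfolding W by (rule range_word_eval_add)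
    moreover have "?R \<in> carrier (cube_End x)" using as by auto
    ultimately show ?case
      using insert.prems(2) by (simp add: a_assoc)
  qed
  have "(UNIV :: bit set) = {0, 1}"
    by (auto intro: bit.exhaust)
  then have "finite (UNIV :: bit set)"
    by (metis finite.emptyI finite.insertI)
  then have "finite (cube x)"
    using assms by (auto simp: cube_def intro: finite_PiE)
  have "T \<in> ?W" if "T \<in> carrier (cube_End x)" for T
  proof (rule *[OF \<open>finite (cube x)\<close> order_refl that])
    fix h assume h: "h \<in> ?B" "\<And>v. v \<in> cube x \<Longrightarrow> h v = 0"
    have "h = 0 \<odot>\<^bsub>bool_functions x\<^esub> h"
      using h by (intro bool_functions_eqI) (auto simp: bool_functions_def)
    moreover have "T (0 \<odot>\<^bsub>bool_functions x\<^esub> h) = 0 \<odot>\<^bsub>bool_functions x\<^esub> T h"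
      using that h(1) by (simp add: End_algebra_def del: B.smult_zero_left)
    ultimately have "T h = 0 \<odot>\<^bsub>bool_functions x\<^esub> T h"
      by (simp only:)
    then show "T h = \<zero>\<^bsub>bool_functions x\<^esub>"
      using End_mem[OF that h(1)] by simp
  qed
  then show ?thesis
    unfolding W by auto
qed

section \<open>The algebra presented by the Boole-Weyl relations\<close>

definition bw_rel :: "'a set \<Rightarrow> 'a oper rel" where
  "bw_rel x = {(p, q). bw_cong x p q}"

abbreviation bw_class :: "'a set \<Rightarrow> 'a oper \<Rightarrow> 'a oper set" where
  "bw_class x p \<equiv> bw_rel x `` {p}"

text \<open>This is the construction of \<open>oper_quot\<close> with the congruence generated by the relations in
  place of equality of valuations. The two turn out to coincide for finite \<open>x\<close>, which transfers
  the algebra structure proved here to \<open>oper_quot\<close>.\<close>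

definition bw_algebra :: "'a set \<Rightarrow> (bit, 'a oper set) module" where
  "bw_algebra x =
    \<lparr>carrier = opers x // bw_rel x,
     mult = (\<lambda>P Q. \<Union>p\<in>P. \<Union>q\<in>Q. bw_class x (p [*] q)),
     one = bw_class x One,
     zero = bw_class x Zer,
     add = (\<lambda>P Q. \<Union>p\<in>P. \<Union>q\<in>Q. bw_class x (p [+] q)),
     smult = (\<lambda>c P. if c = 0 then bw_class x Zer else P)\<rparr>"

lemma bw_cong_opers:
  assumes "bw_cong x p q"
  shows "p \<in> opers x \<and> q \<in> opers x"
  using assms by induction (auto intro: opers.intros)

lemma equiv_bw_rel: "equiv (opers x) (bw_rel x)"
proof (rule equivI)
  show "bw_rel x \<subseteq> opers x \<times> opers x"
    using bw_cong_opers by (fastforce simp: bw_rel_def)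
  show "refl_on (opers x) (bw_rel x)"
    by (auto simp: bw_rel_def intro: refl_onI bw_refl)
  show "sym (bw_rel x)"
    by (auto simp: bw_rel_def intro: symI bw_sym)
  show "trans (bw_rel x)"
    by (auto simp: bw_rel_def intro: transI bw_trans)
qed

lemma bw_class_eq_iff:
  "p \<in> opers x \<Longrightarrow> q \<in> opers x \<Longrightarrow> bw_class x p = bw_class x q \<longleftrightarrow> bw_cong x p q"
  using eq_equiv_class_iff[OF equiv_bw_rel] by (auto simp: bw_rel_def)

lemma bw_class_eqI: "bw_cong x p q \<Longrightarrow> bw_class x p = bw_class x q"
  using bw_class_eq_iff bw_cong_opers by blast

lemma carrier_bw_algebra: "carrier (bw_algebra x) = bw_class x ` opers x"
  by (auto simp: bw_algebra_def quotient_def)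

lemma carrier_bw_algebraE:
  assumes "P \<in> carrier (bw_algebra x)"
  obtains p where "p \<in> opers x" "P = bw_class x p"
  using assms by (auto simp: carrier_bw_algebra)

lemma bw_class_mem [simp]: "p \<in> opers x \<Longrightarrow> bw_class x p \<in> carrier (bw_algebra x)"
  by (simp add: carrier_bw_algebra)

lemma bw_algebra_simps [simp]:
  "\<zero>\<^bsub>bw_algebra x\<^esub> = bw_class x Zer" "\<one>\<^bsub>bw_algebra x\<^esub> = bw_class x One"
  "c \<odot>\<^bsub>bw_algebra x\<^esub> P = (if c = 0 then bw_class x Zer else P)"
  by (simp_all add: bw_algebra_def)

lemma bw_algebra_mult [simp]:
  assumes "p \<in> opers x" "q \<in> opers x"
  shows "bw_class x p \<otimes>\<^bsub>bw_algebra x\<^esub> bw_class x q = bw_class x (p [*] q)"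
proof -
  have "congruent2 (bw_rel x) (bw_rel x) (\<lambda>p q. bw_class x (p [*] q))"
    by (rule congruent2I', rule bw_class_eqI, rule bw_mul) (auto simp: bw_rel_def)
  then show ?thesis
    using UN_equiv_class2[OF equiv_bw_rel equiv_bw_rel _ assms] by (simp add: bw_algebra_def)
qed

lemma bw_algebra_add [simp]:
  assumes "p \<in> opers x" "q \<in> opers x"
  shows "bw_class x p \<oplus>\<^bsub>bw_algebra x\<^esub> bw_class x q = bw_class x (p [+] q)"
proof -
  have "congruent2 (bw_rel x) (bw_rel x) (\<lambda>p q. bw_class x (p [+] q))"
    by (rule congruent2I', rule bw_class_eqI, rule bw_add) (auto simp: bw_rel_def)
  then show ?thesis
    using UN_equiv_class2[OF equiv_bw_rel equiv_bw_rel _ assms] by (simp add: bw_algebra_def)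
qed

lemma z2_algebra_bw_algebra: "z2_algebra (bw_algebra x)"
proof -
  let ?A = "bw_algebra x"
  note [simp] = opers.intros bw_class_eq_iff
  note [intro] = bw_refl bw_add_assoc bw_add_comm bw_add_zero bw_add_self bw_mul_assoc
    bw_one_left bw_one_right bw_distrib_left bw_distrib_right
  have zero_left: "bw_cong x (Zer [+] p) p" if "p \<in> opers x" for p
    using that by (blast intro: bw_trans opers.intros)
  \<comment> \<open>That \<open>0\<close> annihilates is not among the rules of the congruence; it follows from \<open>0 = 1 + 1\<close>
    by distributivity.\<close>
  have mul_zero: "bw_cong x (p [*] Zer) Zer" if p: "p \<in> opers x" for p
  proof -
    have "bw_cong x (p [*] (One [+] One)) (p [*] Zer)"
      using p by (blast intro: bw_mul opers.intros)
    moreover have "bw_cong x (p [*] (One [+] One)) (p [*] One [+] p [*] One)"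
      using p by (blast intro: opers.intros)
    moreover have "bw_cong x (p [*] One [+] p [*] One) Zer"
      using p by (blast intro: opers.intros)
    ultimately show ?thesis
      by (meson bw_trans bw_sym)
  qed
  have zero_mul: "bw_cong x (Zer [*] p) Zer" if p: "p \<in> opers x" for p
  proof -
    have "bw_cong x ((One [+] One) [*] p) (Zer [*] p)"
      using p by (blast intro: bw_mul opers.intros)
    moreover have "bw_cong x ((One [+] One) [*] p) (One [*] p [+] One [*] p)"
      using p by (blast intro: opers.intros)
    moreover have "bw_cong x (One [*] p [+] One [*] p) Zer"
      using p by (blast intro: opers.intros)
    ultimately show ?thesis
      by (meson bw_trans bw_sym)
  qed
  note [simp] = bw_refl bw_add_assoc bw_add_comm bw_add_zero bw_add_self bw_mul_assoc bw_one_left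
    bw_one_right bw_distrib_left bw_distrib_right zero_left mul_zero zero_mul
  have ab: "abelian_group ?A"
  proof (rule abelian_groupI)
    fix P assume P: "P \<in> carrier ?A"
    then obtain p where "p \<in> opers x" "P = bw_class x p"
      by (rule carrier_bw_algebraE)
    then have "P \<oplus>\<^bsub>?A\<^esub> P = \<zero>\<^bsub>?A\<^esub>"
      by simp
    then show "\<exists>Q\<in>carrier ?A. Q \<oplus>\<^bsub>?A\<^esub> P = \<zero>\<^bsub>?A\<^esub>"
      using P by blast
  qed (((erule carrier_bw_algebraE)+)?; simp)+
  have monoid: "monoid ?A"
    by (rule monoidI; ((erule carrier_bw_algebraE)+)?; simp)
  have "ring ?A"
    by (rule ringI[OF ab monoid]; (erule carrier_bw_algebraE)+; simp)
  moreover have "module F2 ?A"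
  proof (rule moduleI[OF cring_F2 ab])
    fix a b :: bit and P assume "P \<in> carrier ?A"
    then show "(a \<oplus>\<^bsub>F2\<^esub> b) \<odot>\<^bsub>?A\<^esub> P = a \<odot>\<^bsub>?A\<^esub> P \<oplus>\<^bsub>?A\<^esub> b \<odot>\<^bsub>?A\<^esub> P"
      by (elim carrier_bw_algebraE; cases a; cases b)
        (simp_all add: bw_sym[OF zero_left] bw_sym[OF bw_add_zero] bw_sym[OF bw_add_self])
  qed (((erule carrier_bw_algebraE)+)?; simp add: bw_sym[OF bw_add_zero])+
  moreover have "(c \<odot>\<^bsub>?A\<^esub> P) \<otimes>\<^bsub>?A\<^esub> Q = c \<odot>\<^bsub>?A\<^esub> (P \<otimes>\<^bsub>?A\<^esub> Q) \<and>
      P \<otimes>\<^bsub>?A\<^esub> (c \<odot>\<^bsub>?A\<^esub> Q) = c \<odot>\<^bsub>?A\<^esub> (P \<otimes>\<^bsub>?A\<^esub> Q)"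
    if "P \<in> carrier ?A" "Q \<in> carrier ?A" for c P Q
    using that by (elim carrier_bw_algebraE) simp
  ultimately show ?thesis
    unfolding z2_algebra_def by blast
qed

lemma word_eval_bw_algebra:
  "p \<in> opers x \<Longrightarrow>
   word_eval (bw_algebra x) (\<lambda>a. bw_class x (Ltr a)) (\<lambda>a. bw_class x (Tld a)) p = bw_class x p"
  by (induction rule: opers.induct) simp_all

lemma boole_weyl_bw_algebra:
  "finite x \<Longrightarrow> boole_weyl x (bw_algebra x) (\<lambda>a. bw_class x (Ltr a)) (\<lambda>a. bw_class x (Tld a))"
  by (auto simp: boole_weyl_def z2_algebra_bw_algebra word_eval_bw_algebra opers.intros
      bw_class_eq_iff carrier_bw_algebra)

lemma boole_weyl_relations_bw_algebra:
  "boole_weyl_relations (bw_algebra x) x (\<lambda>a. bw_class x (Ltr a)) (\<lambda>a. bw_class x (Tld a))"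
proof (intro boole_weyl_relations.intro boole_weyl_relations_axioms.intro)
  show "ring (bw_algebra x)"
    by (rule z2_algebraD[OF z2_algebra_bw_algebra])
next
  fix P assume "P \<in> carrier (bw_algebra x)"
  then obtain p where "p \<in> opers x" "P = bw_class x p"
    by (auto simp: carrier_bw_algebra)
  then show "P \<oplus>\<^bsub>bw_algebra x\<^esub> P = \<zero>\<^bsub>bw_algebra x\<^esub>"
    by (simp add: opers.intros bw_class_eq_iff bw_add_self)
qed (auto simp: opers.intros bw_class_eq_iff carrier_bw_algebra intro: bw_x_idem
    bw_y_square bw_y_x bw_x_comm bw_y_comm bw_y_x_comm)

text \<open>Soundness holds because multiplication and differentiation satisfy the relations;
  completeness is the comparison of words with equal valuations in the presented algebra, where
  equality of values is the congruence itself.\<close>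

theorem valuation_eq_iff_bw_cong:
  assumes "finite x" "p \<in> opers x" "q \<in> opers x"
  shows "valuation x p = valuation x q \<longleftrightarrow> bw_cong x p q"
proof
  assume "valuation x p = valuation x q"
  from boole_weyl_relations.word_eval_eq_if_valuation_eq[OF boole_weyl_relations_bw_algebra assms this]
  show "bw_cong x p q"
    using assms by (simp add: word_eval_bw_algebra bw_class_eq_iff)
next
  assume "bw_cong x p q"
  then show "valuation x p = valuation x q"
    using boole_weyl_relations.word_eval_bw_cong[OF boole_weyl_relations_End, of x p q]
    by (simp add: valuation_def)
qed

lemma oper_rel_eq_bw_rel: "finite x \<Longrightarrow> oper_rel x = bw_rel x"
  using bw_cong_opers by (auto simp: oper_rel_def bw_rel_def valuation_eq_iff_bw_cong)

lemma oper_quot_eq_bw_algebra: "finite x \<Longrightarrow> oper_quot x = bw_algebra x"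
  unfolding oper_quot_def bw_algebra_def by (simp only: oper_rel_eq_bw_rel)

lemma boole_weyl_End:
  assumes "finite x"
  shows "boole_weyl x (cube_End x) (coord_mult x) (bool_deriv x)"
  using assms valuation_surj[OF assms] valuation_eq_iff_bw_cong[OF assms]
  by (simp add: boole_weyl_def z2_algebra_End_algebra module_bool_functions coord_mult_mem
      bool_deriv_mem valuation_def)

section \<open>Isomorphisms determined by generators\<close>

lemma word_eval_map_oper:
  assumes "p \<in> opers x" "\<And>a. a \<in> x \<Longrightarrow> X a = X' (\<sigma> a)" "\<And>a. a \<in> x \<Longrightarrow> Y a = Y' (\<sigma> a)"
  shows "word_eval A X Y p = word_eval A X' Y' (map_oper \<sigma> p)"
  using assms by (induction rule: opers.induct) simp_all

lemma map_oper_opers: "p \<in> opers x \<Longrightarrow> \<sigma> ` x \<subseteq> y \<Longrightarrow> map_oper \<sigma> p \<in> opers y"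
  by (induction rule: opers.induct) (auto intro: opers.intros)

lemma z2_alg_hom_word_eval:
  assumes "h \<in> z2_alg_hom A B" "z2_algebra A" "z2_algebra B"
    "X \<in> x \<rightarrow> carrier A" "Y \<in> x \<rightarrow> carrier A" "p \<in> opers x"
  shows "h (word_eval A X Y p) = word_eval B (\<lambda>a. h (X a)) (\<lambda>a. h (Y a)) p"
proof -
  interpret A: ring A by (rule z2_algebraD[OF assms(2)])
  have hom: "h \<in> ring_hom A B" using assms(1) by (simp add: z2_alg_hom_def)
  have mem: "word_eval A X Y q \<in> carrier A" if "q \<in> opers x" for q
    using that assms(4,5) by (induction rule: opers.induct) auto
  show ?thesis
    using assms(6)
  proof (induction rule: opers.induct)
    case 3
    then show ?case
      using ring_hom_zero[OF hom] assms(2,3) by (simp add: z2_algebraD)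
  qed (simp_all add: ring_hom_one[OF hom] ring_hom_mult[OF hom] ring_hom_add[OF hom] mem)
qed

text \<open>The comparison of two algebras with the same presentation: an element is written as a word
  in the generators of the first, and the word is evaluated in the second. The result does not
  depend on the word, since both algebras have the same relations.\<close>

definition word_transfer ::
  "'a set \<Rightarrow> (bit, 'm) module \<Rightarrow> ('a \<Rightarrow> 'm) \<Rightarrow> ('a \<Rightarrow> 'm) \<Rightarrow>
    (bit, 'n) module \<Rightarrow> ('a \<Rightarrow> 'n) \<Rightarrow> ('a \<Rightarrow> 'n) \<Rightarrow> 'm \<Rightarrow> 'n" where
  "word_transfer x A X Y B X' Y' u =
    word_eval B X' Y' (SOME p. p \<in> opers x \<and> word_eval A X Y p = u)"

lemma word_transfer_word_eval:
  assumes "boole_weyl x A X Y" "boole_weyl x B X' Y'" "p \<in> opers x"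
  shows "word_transfer x A X Y B X' Y' (word_eval A X Y p) = word_eval B X' Y' p"
proof -
  define q where "q = (SOME q. q \<in> opers x \<and> word_eval A X Y q = word_eval A X Y p)"
  have "q \<in> opers x \<and> word_eval A X Y q = word_eval A X Y p"
    unfolding q_def by (rule someI[of _ p]) (use assms in simp)
  then have "bw_cong x q p" "q \<in> opers x"
    using assms by (auto simp: boole_weyl_def)
  then have "word_eval B X' Y' q = word_eval B X' Y' p"
    using assms by (auto simp: boole_weyl_def)
  then show ?thesis
    by (simp add: word_transfer_def q_def)
qed

lemma word_transfer_iso:
  assumes A: "boole_weyl x A X Y" and B: "boole_weyl x B X' Y'"
  shows "word_transfer x A X Y B X' Y' \<in> z2_alg_iso A B"
proof -
  let ?h = "word_transfer x A X Y B X' Y'"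
  interpret A: z2_module A
    using A by (simp add: boole_weyl_def z2_module_def z2_algebraD)
  interpret B: z2_module B
    using B by (simp add: boole_weyl_def z2_module_def z2_algebraD)
  note h = word_transfer_word_eval[OF A B]
  have cA: "carrier A = word_eval A X Y ` opers x" and cB: "carrier B = word_eval B X' Y' ` opers x"
    using A B by (simp_all add: boole_weyl_def)
  have hom: "?h \<in> ring_hom A B"
  proof (rule ring_hom_memI)
    fix u assume "u \<in> carrier A"
    then obtain p where p: "p \<in> opers x" "u = word_eval A X Y p"
      by (auto simp: cA)
    then show "?h u \<in> carrier B"
      using p by (simp add: h cB)
    fix w assume "w \<in> carrier A"
    then obtain q where q: "q \<in> opers x" "w = word_eval A X Y q"
      by (auto simp: cA)
    show "?h (u \<otimes>\<^bsub>A\<^esub> w) = ?h u \<otimes>\<^bsub>B\<^esub> ?h w"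
      using h[OF opers.intros(5)[OF p(1) q(1)]] p q by (simp add: h)
    show "?h (u \<oplus>\<^bsub>A\<^esub> w) = ?h u \<oplus>\<^bsub>B\<^esub> ?h w"
      using h[OF opers.intros(6)[OF p(1) q(1)]] p q by (simp add: h)
  next
    show "?h \<one>\<^bsub>A\<^esub> = \<one>\<^bsub>B\<^esub>"
      using h[OF opers.intros(4)] by simp
  qed
  have "inj_on ?h (carrier A)"
  proof (rule inj_onI)
    fix u w assume "u \<in> carrier A" "w \<in> carrier A" "?h u = ?h w"
    then obtain p q where "p \<in> opers x" "q \<in> opers x" "u = word_eval A X Y p" "w = word_eval A X Y q"
      "word_eval B X' Y' p = word_eval B X' Y' q"
      by (auto simp: cA h)
    then show "u = w"
      using A B by (simp add: boole_weyl_def)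
  qed
  moreover have "?h ` carrier A = carrier B"
    by (simp add: cA cB image_image h)
  moreover have "?h (c \<odot>\<^bsub>A\<^esub> u) = c \<odot>\<^bsub>B\<^esub> ?h u" if "u \<in> carrier A" for c u
  proof -
    have "?h \<zero>\<^bsub>A\<^esub> = \<zero>\<^bsub>B\<^esub>"
      using h[OF opers.intros(3)] by simp
    moreover have "?h u \<in> carrier B"
      using hom that by (rule ring_hom_closed)
    ultimately show ?thesis
      using that by (cases c) simp_all
  qed
  ultimately show ?thesis
    using hom by (simp add: z2_alg_iso_def z2_alg_hom_def ring_iso_def bij_betw_def)
qed

text \<open>Both ways around the naturality square are homomorphisms, hence determined by the images
  of the generators; on the value of a word \<open>p\<close> both yield the value of \<open>p\<close> with its letters
  renamed.\<close>

theorem naturally_isomorphic_if_generators_natural: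
  assumes F: "boole_weyl_functor F" and G: "boole_weyl_functor G"
    and gens: "\<And>x y \<sigma> a. finite x \<Longrightarrow> finite y \<Longrightarrow> \<sigma> \<in> bijs x y \<Longrightarrow> a \<in> x \<Longrightarrow>
      mor F x y \<sigma> (genx F x a) = genx F y (\<sigma> a) \<and> mor F x y \<sigma> (geny F x a) = geny F y (\<sigma> a) \<and>
      mor G x y \<sigma> (genx G x a) = genx G y (\<sigma> a) \<and> mor G x y \<sigma> (geny G x a) = geny G y (\<sigma> a)"
  shows "naturally_isomorphic F G"
proof -
  define \<eta> where "\<eta> x = word_transfer x (obj F x) (genx F x) (geny F x) (obj G x) (genx G x) (geny G x)" for x
  have bwF: "boole_weyl x (obj F x) (genx F x) (geny F x)"
    and bwG: "boole_weyl x (obj G x) (genx G x) (geny G x)" if "finite x" for x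
    using F G that by (auto simp: boole_weyl_functor_def)
  have nat: "\<eta> y (mor F x y \<sigma> u) = mor G x y \<sigma> (\<eta> x u)"
    if fin: "finite x" "finite y" and \<sigma>: "\<sigma> \<in> bijs x y" and u: "u \<in> carrier (obj F x)" for x y \<sigma> u
  proof -
    obtain p where p: "p \<in> opers x" "u = word_eval (obj F x) (genx F x) (geny F x) p"
      using bwF[OF fin(1)] u unfolding boole_weyl_def by (metis imageE)
    have "mor F x y \<sigma> \<in> z2_alg_hom (obj F x) (obj F y)" "mor G x y \<sigma> \<in> z2_alg_hom (obj G x) (obj G y)"
      using F G fin \<sigma> by (auto simp: boole_weyl_functor_def)
    then have
      "mor F x y \<sigma> u = word_eval (obj F y) (\<lambda>a. mor F x y \<sigma> (genx F x a)) (\<lambda>a. mor F x y \<sigma> (geny F x a)) p"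
      "mor G x y \<sigma> (word_eval (obj G x) (genx G x) (geny G x) p) =
        word_eval (obj G y) (\<lambda>a. mor G x y \<sigma> (genx G x a)) (\<lambda>a. mor G x y \<sigma> (geny G x a)) p"
      unfolding p(2) using bwF[OF fin(1)] bwF[OF fin(2)] bwG[OF fin(1)] bwG[OF fin(2)] p(1)
      by (intro z2_alg_hom_word_eval[where x = x]; simp add: boole_weyl_def)+
    moreover have
      "word_eval (obj F y) (\<lambda>a. mor F x y \<sigma> (genx F x a)) (\<lambda>a. mor F x y \<sigma> (geny F x a)) p =
        word_eval (obj F y) (genx F y) (geny F y) (map_oper \<sigma> p)"
      "word_eval (obj G y) (\<lambda>a. mor G x y \<sigma> (genx G x a)) (\<lambda>a. mor G x y \<sigma> (geny G x a)) p =
        word_eval (obj G y) (genx G y) (geny G y) (map_oper \<sigma> p)"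
      by (rule word_eval_map_oper[OF p(1)]; use gens[OF fin \<sigma>] in blast)+
    moreover have "map_oper \<sigma> p \<in> opers y"
      using p(1) \<sigma> by (intro map_oper_opers[of p x]) (auto simp: bijs_def bij_betw_def)
    ultimately show ?thesis
      using p bwF[OF fin(1)] bwF[OF fin(2)] bwG[OF fin(1)] bwG[OF fin(2)]
      by (simp add: \<eta>_def word_transfer_word_eval)
  qed
  show ?thesis
    unfolding naturally_isomorphic_def
  proof (intro exI[of _ \<eta>] conjI allI impI ballI)
    fix x :: "'a set" assume "finite x"
    then show "\<eta> x \<in> z2_alg_iso (obj F x) (obj G x)"
      unfolding \<eta>_def by (intro word_transfer_iso bwF bwG)
  qed (rule nat)
qed

section \<open>The two functors\<close>

text \<open>Injectivity is needed for the one relation that involves distinct letters.\<close>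

lemma bw_cong_map_oper:
  assumes "bw_cong x p q" "inj_on \<sigma> x" "\<sigma> ` x \<subseteq> y"
  shows "bw_cong y (map_oper \<sigma> p) (map_oper \<sigma> q)"
  using assms(1)
proof induction
  case (bw_trans p q r)
  then show ?case by (blast intro: bw_cong.bw_trans)
next
  case (bw_y_x_comm a b)
  then show ?case
    using assms(2,3) by (auto intro!: bw_cong.bw_y_x_comm simp: inj_on_eq_iff)
qed (use assms(3) in \<open>auto simp: map_oper_opers intro: bw_cong.intros(1,2,4-19)\<close>)

lemma oper_mor_class:
  assumes "finite x" "finite y" "\<sigma> \<in> bijs x y" "p \<in> opers x"
  shows "mor oper_functor x y \<sigma> (bw_class x p) = bw_class y (map_oper \<sigma> p)"
proof -
  have "inj_on \<sigma> x" "\<sigma> ` x \<subseteq> y"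
    using assms(3) by (auto simp: bijs_def bij_betw_def)
  then have "(\<lambda>q. bw_class y (map_oper \<sigma> q)) respects bw_rel x"
    by (intro congruentI bw_class_eqI bw_cong_map_oper) (auto simp: bw_rel_def)
  then show ?thesis
    using UN_equiv_class[OF equiv_bw_rel _ assms(4)] assms(1,2)
    by (simp add: oper_functor_def oper_rel_eq_bw_rel)
qed

lemma map_oper_id_on: "p \<in> opers x \<Longrightarrow> map_oper (\<lambda>a\<in>x. a) p = p"
  by (induction rule: opers.induct) simp_all

lemma map_oper_compose_on: "p \<in> opers x \<Longrightarrow> map_oper (compose x \<tau> \<sigma>) p = map_oper \<tau> (map_oper \<sigma> p)"
  by (induction rule: opers.induct) (simp_all add: compose_def)

lemma id_mem_bijs: "(\<lambda>a\<in>x. a) \<in> bijs x x"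
  by (auto simp: bijs_def bij_betw_def inj_on_def)

lemma compose_mem_bijs: "\<sigma> \<in> bijs x y \<Longrightarrow> \<tau> \<in> bijs y z \<Longrightarrow> compose x \<tau> \<sigma> \<in> bijs x z"
  by (auto simp: bijs_def intro: bij_betw_compose)

lemma bijs_mem: "\<sigma> \<in> bijs x y \<Longrightarrow> a \<in> x \<Longrightarrow> \<sigma> a \<in> y"
  by (auto simp: bijs_def bij_betw_def)

lemma map_oper_bijs_opers: "\<sigma> \<in> bijs x y \<Longrightarrow> p \<in> opers x \<Longrightarrow> map_oper \<sigma> p \<in> opers y"
  by (rule map_oper_opers) (auto simp: bijs_mem)

lemma oper_functor_obj: "finite x \<Longrightarrow> obj oper_functor x = bw_algebra x"
  by (simp add: oper_functor_def oper_quot_eq_bw_algebra)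

lemma oper_functor_gens:
  assumes "finite x"
  shows "genx oper_functor x = (\<lambda>a. bw_class x (Ltr a))" "geny oper_functor x = (\<lambda>a. bw_class x (Tld a))"
  using assms by (simp_all add: oper_functor_def oper_rel_eq_bw_rel)

theorem boole_weyl_functor_oper: "boole_weyl_functor oper_functor"
  unfolding boole_weyl_functor_def
proof (intro conjI allI impI ballI)
  fix x :: "'a set" assume "finite x"
  then show "boole_weyl x (obj oper_functor x) (genx oper_functor x) (geny oper_functor x)"
    by (simp add: oper_functor_obj oper_functor_gens boole_weyl_bw_algebra)
next
  fix x y :: "'a set" and \<sigma> assume fin: "finite x" "finite y" and \<sigma>: "\<sigma> \<in> bijs x y"
  note [simp] = oper_mor_class[OF fin \<sigma>] map_oper_bijs_opers[OF \<sigma>] opers.intros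
  have "mor oper_functor x y \<sigma> \<in> ring_hom (bw_algebra x) (bw_algebra y)"
    by (rule ring_hom_memI; ((erule carrier_bw_algebraE)+)?; simp)
  moreover have "mor oper_functor x y \<sigma> (c \<odot>\<^bsub>bw_algebra x\<^esub> P) = c \<odot>\<^bsub>bw_algebra y\<^esub> mor oper_functor x y \<sigma> P" for c P
    by simp
  ultimately show "mor oper_functor x y \<sigma> \<in> z2_alg_hom (obj oper_functor x) (obj oper_functor y)"
    by (simp add: z2_alg_hom_def oper_functor_obj fin)
next
  fix x :: "'a set" and P assume fin: "finite x" and "P \<in> carrier (obj oper_functor x)"
  then have "P \<in> carrier (bw_algebra x)"
    by (simp add: oper_functor_obj)
  then show "mor oper_functor x x (\<lambda>a\<in>x. a) P = P"
    by (elim carrier_bw_algebraE)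
      (simp add: oper_mor_class[OF fin fin id_mem_bijs] map_oper_id_on)
next
  fix x y z :: "'a set" and \<sigma> \<tau> P
  assume fin: "finite x" "finite y" "finite z" and \<sigma>: "\<sigma> \<in> bijs x y" and \<tau>: "\<tau> \<in> bijs y z"
    and "P \<in> carrier (obj oper_functor x)"
  then have "P \<in> carrier (bw_algebra x)"
    by (simp add: oper_functor_obj)
  then show "mor oper_functor x z (compose x \<tau> \<sigma>) P = mor oper_functor y z \<tau> (mor oper_functor x y \<sigma> P)"
    by (elim carrier_bw_algebraE)
      (simp add: oper_mor_class[OF fin(1,3) compose_mem_bijs[OF \<sigma> \<tau>]] oper_mor_class[OF fin(1,2) \<sigma>]
        oper_mor_class[OF fin(2,3) \<tau>] map_oper_bijs_opers[OF \<sigma>] map_oper_compose_on)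
qed

lemma compose_mem_cube: "compose x g \<sigma> \<in> cube x"
  by (simp add: mem_cube_iff compose_def)

lemma push_mem [simp]: "push x y \<sigma> f \<in> carrier (bool_functions y)"
  by (simp add: push_def)

lemma push_id: "f \<in> carrier (bool_functions x) \<Longrightarrow> push x x (\<lambda>a\<in>x. a) f = f"
proof (rule bool_functions_eqI)
  fix g assume "g \<in> cube x"
  moreover from this have "compose x g (\<lambda>a\<in>x. a) = g"
    by (intro cube_ext[of _ x] compose_mem_cube) (simp_all add: compose_def)
  ultimately show "push x x (\<lambda>a\<in>x. a) f g = f g"
    by (simp add: push_def)
qed simp_all

lemma push_compose:
  assumes "\<sigma> \<in> bijs x y" "\<tau> \<in> bijs y z"
  shows "push x z (compose x \<tau> \<sigma>) f = push y z \<tau> (push x y \<sigma> f)"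
proof (rule bool_functions_eqI)
  fix g assume "g \<in> cube z"
  moreover have "compose x g (compose x \<tau> \<sigma>) = compose x (compose y g \<tau>) \<sigma>"
    by (rule cube_ext[OF compose_mem_cube compose_mem_cube])
      (use bijs_mem[OF assms(1)] in \<open>simp add: compose_def\<close>)
  ultimately show "push x z (compose x \<tau> \<sigma>) f g = push y z \<tau> (push x y \<sigma> f) g"
    by (simp add: push_def compose_mem_cube)
qed simp_all

lemma bijs_inverse:
  assumes "\<sigma> \<in> bijs x y"
  obtains \<tau> where "\<tau> \<in> bijs y x" "compose x \<tau> \<sigma> = (\<lambda>a\<in>x. a)" "compose y \<sigma> \<tau> = (\<lambda>a\<in>y. a)"
proof
  have bij: "bij_betw \<sigma> x y" using assms by (simp add: bijs_def)
  show "restrict (inv_into x \<sigma>) y \<in> bijs y x"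
    using bij_betw_inv_into[OF bij] by (simp add: bijs_def cong: bij_betw_cong)
  show "compose x (restrict (inv_into x \<sigma>) y) \<sigma> = (\<lambda>a\<in>x. a)"
    using bij bijs_mem[OF assms] by (auto simp: compose_def bij_betw_def fun_eq_iff)
  show "compose y \<sigma> (restrict (inv_into x \<sigma>) y) = (\<lambda>a\<in>y. a)"
    using bij by (auto simp: compose_def bij_betw_def fun_eq_iff f_inv_into_f)
qed

lemma push_bij:
  assumes "\<sigma> \<in> bijs x y"
  shows "bij_betw (push x y \<sigma>) (carrier (bool_functions x)) (carrier (bool_functions y))"
proof -
  obtain \<tau> where \<tau>: "\<tau> \<in> bijs y x" "compose x \<tau> \<sigma> = (\<lambda>a\<in>x. a)" "compose y \<sigma> \<tau> = (\<lambda>a\<in>y. a)"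
    using bijs_inverse[OF assms] .
  have "push y x \<tau> (push x y \<sigma> f) = f" if "f \<in> carrier (bool_functions x)" for f
    using push_compose[OF assms \<tau>(1), of f] \<tau>(2) push_id[OF that] by simp
  moreover have "push x y \<sigma> (push y x \<tau> f) = f" if "f \<in> carrier (bool_functions y)" for f
    using push_compose[OF \<tau>(1) assms, of f] \<tau>(3) push_id[OF that] by simp
  ultimately show ?thesis
    by (intro bij_betw_byWitness[where f' = "push y x \<tau>"]) auto
qed

lemma push_add:
  "push x y \<sigma> (f \<oplus>\<^bsub>bool_functions x\<^esub> h) = push x y \<sigma> f \<oplus>\<^bsub>bool_functions y\<^esub> push x y \<sigma> h"
  by (auto simp: push_def bool_functions_def compose_mem_cube fun_eq_iff restrict_def)

lemma push_smult:
  "push x y \<sigma> (c \<odot>\<^bsub>bool_functions x\<^esub> f) = c \<odot>\<^bsub>bool_functions y\<^esub> push x y \<sigma> f"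
  by (auto simp: push_def bool_functions_def compose_mem_cube fun_eq_iff restrict_def)

lemma push_coord_mult:
  assumes "\<sigma> \<in> bijs x y" "a \<in> x" "f \<in> carrier (bool_functions x)"
  shows "push x y \<sigma> (coord_mult x a f) = coord_mult y (\<sigma> a) (push x y \<sigma> f)"
proof (rule bool_functions_eqI)
  show "coord_mult y (\<sigma> a) (push x y \<sigma> f) \<in> carrier (bool_functions y)"
    by (rule End_mem[OF coord_mult_mem push_mem])
next
  fix g assume "g \<in> cube y"
  moreover have "compose x g \<sigma> a = g (\<sigma> a)"
    using assms(2) by (simp add: compose_def)
  ultimately show "push x y \<sigma> (coord_mult x a f) g = coord_mult y (\<sigma> a) (push x y \<sigma> f) g"
    using assms(3) by (simp add: coord_mult_apply) (simp add: push_def compose_mem_cube)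
qed simp

lemma push_bool_deriv:
  assumes "\<sigma> \<in> bijs x y" "a \<in> x" "f \<in> carrier (bool_functions x)"
  shows "push x y \<sigma> (bool_deriv x a f) = bool_deriv y (\<sigma> a) (push x y \<sigma> f)"
proof (rule bool_functions_eqI)
  show "bool_deriv y (\<sigma> a) (push x y \<sigma> f) \<in> carrier (bool_functions y)"
    by (rule End_mem[OF bool_deriv_mem]) (simp_all add: bijs_mem[OF assms(1,2)])
next
  fix g assume g: "g \<in> cube y"
  have inj: "inj_on \<sigma> x" using assms(1) by (simp add: bijs_def bij_betw_def)
  have "(compose x g \<sigma>)(a := compose x g \<sigma> a + 1) = compose x (g(\<sigma> a := g (\<sigma> a) + 1)) \<sigma>"
    using assms(2) inj_on_eq_iff[OF inj] by (auto simp: compose_def fun_eq_iff)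
  then show "push x y \<sigma> (bool_deriv x a f) g = bool_deriv y (\<sigma> a) (push x y \<sigma> f) g"
    using assms g bijs_mem[OF assms(1,2)]
    by (simp add: bool_deriv_apply) (simp add: push_def compose_mem_cube)
qed simp

text \<open>The action of a bijection on endomorphisms is conjugation by \<open>push x y \<sigma>\<close>. As every function
  on the second cube has the form \<open>push x y \<sigma> f\<close>, the following equation characterises it, and all
  properties of the action are derived from it without reference to the inverse map.\<close>

lemma End_mor_apply:
  assumes "\<sigma> \<in> bijs x y" "f \<in> carrier (bool_functions x)"
  shows "mor End_functor x y \<sigma> T (push x y \<sigma> f) = push x y \<sigma> (T f)"
  using assms(2) by (simp add: End_functor_def bij_betw_inv_into_left[OF push_bij[OF assms(1)]])

lemma End_mor_extensional: "mor End_functor x y \<sigma> T \<in> extensional (carrier (bool_functions y))"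
  by (simp add: End_functor_def)

lemma End_mor_eqI:
  assumes "\<sigma> \<in> bijs x y" "S \<in> extensional (carrier (bool_functions y))"
    "\<And>f. f \<in> carrier (bool_functions x) \<Longrightarrow> push x y \<sigma> (T f) = S (push x y \<sigma> f)"
  shows "mor End_functor x y \<sigma> T = S"
proof (rule extensionalityI[OF End_mor_extensional assms(2)])
  fix h assume "h \<in> carrier (bool_functions y)"
  then obtain f where "f \<in> carrier (bool_functions x)" "h = push x y \<sigma> f"
    using push_bij[OF assms(1)] by (auto simp: bij_betw_def)
  then show "mor End_functor x y \<sigma> T h = S h"
    by (simp add: End_mor_apply[OF assms(1)] assms(3))
qed

lemma End_algebra_extensional: "S \<in> carrier (End_algebra M) \<Longrightarrow> S \<in> extensional (carrier M)"
  by (simp add: End_algebra_def PiE_iff)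

lemma End_mor_mem:
  assumes \<sigma>: "\<sigma> \<in> bijs x y" and T: "T \<in> carrier (cube_End x)"
  shows "mor End_functor x y \<sigma> T \<in> carrier (cube_End y)"
proof -
  let ?T = "mor End_functor x y \<sigma> T"
  interpret z2_module "bool_functions x"
    using module_bool_functions by (simp add: z2_module_def)
  have surj: "\<exists>f\<in>carrier (bool_functions x). h = push x y \<sigma> f" if "h \<in> carrier (bool_functions y)" for h
    using push_bij[OF \<sigma>] that by (auto simp: bij_betw_def)
  have "?T h \<in> carrier (bool_functions y)" if "h \<in> carrier (bool_functions y)" for h
    using surj[OF that] by (auto simp: End_mor_apply[OF \<sigma>])
  moreover have "?T (h \<oplus>\<^bsub>bool_functions y\<^esub> k) = ?T h \<oplus>\<^bsub>bool_functions y\<^esub> ?T k"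
    if hk: "h \<in> carrier (bool_functions y)" "k \<in> carrier (bool_functions y)" for h k
  proof -
    obtain f f' where f: "f \<in> carrier (bool_functions x)" "h = push x y \<sigma> f"
      "f' \<in> carrier (bool_functions x)" "k = push x y \<sigma> f'"
      using surj[OF hk(1)] surj[OF hk(2)] by blast
    moreover have "T (f \<oplus>\<^bsub>bool_functions x\<^esub> f') = T f \<oplus>\<^bsub>bool_functions x\<^esub> T f'"
      using T f by (simp add: End_algebra_def)
    ultimately show ?thesis
      by (simp add: End_mor_apply[OF \<sigma>] flip: push_add)
  qed
  moreover have "?T (c \<odot>\<^bsub>bool_functions y\<^esub> h) = c \<odot>\<^bsub>bool_functions y\<^esub> ?T h"
    if h: "h \<in> carrier (bool_functions y)" for c h
  proof -
    obtain f where f: "f \<in> carrier (bool_functions x)" "h = push x y \<sigma> f"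
      using surj[OF h] by blast
    moreover have "T (c \<odot>\<^bsub>bool_functions x\<^esub> f) = c \<odot>\<^bsub>bool_functions x\<^esub> T f"
      using T f by (simp add: End_algebra_def)
    ultimately show ?thesis
      by (simp add: End_mor_apply[OF \<sigma>] flip: push_smult)
  qed
  ultimately show ?thesis
    using End_mor_extensional[of x y \<sigma> T] by (simp add: End_algebra_def PiE_iff)
qed

lemma End_mor_hom:
  assumes \<sigma>: "\<sigma> \<in> bijs x y"
  shows "mor End_functor x y \<sigma> \<in> z2_alg_hom (cube_End x) (cube_End y)"
proof -
  let ?h = "mor End_functor x y \<sigma>"
  have "?h \<in> ring_hom (cube_End x) (cube_End y)"
  proof (rule ring_hom_memI)
    fix S assume S: "S \<in> carrier (cube_End x)"
    then show "?h S \<in> carrier (cube_End y)"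
      by (rule End_mor_mem[OF \<sigma>])
    fix T assume T: "T \<in> carrier (cube_End x)"
    show "?h (S \<otimes>\<^bsub>cube_End x\<^esub> T) = ?h S \<otimes>\<^bsub>cube_End y\<^esub> ?h T"
      by (rule End_mor_eqI[OF \<sigma>])
        (simp_all add: End_mor_apply[OF \<sigma>] End_mem[OF T], simp add: End_algebra_def)
    show "?h (S \<oplus>\<^bsub>cube_End x\<^esub> T) = ?h S \<oplus>\<^bsub>cube_End y\<^esub> ?h T"
      by (rule End_mor_eqI[OF \<sigma>]) (simp_all add: End_algebra_def End_mor_apply[OF \<sigma>] push_add)
  next
    show "?h \<one>\<^bsub>cube_End x\<^esub> = \<one>\<^bsub>cube_End y\<^esub>"
      by (rule End_mor_eqI[OF \<sigma>]) (simp_all add: End_algebra_def)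
  qed
  moreover have "?h (c \<odot>\<^bsub>cube_End x\<^esub> S) = c \<odot>\<^bsub>cube_End y\<^esub> ?h S" for c S
    by (rule End_mor_eqI[OF \<sigma>]) (simp_all add: End_algebra_def End_mor_apply[OF \<sigma>] push_smult)
  ultimately show ?thesis
    by (simp add: z2_alg_hom_def)
qed

lemma End_functor_simps:
  "obj End_functor x = cube_End x" "genx End_functor = coord_mult" "geny End_functor = bool_deriv"
  by (simp_all add: End_functor_def)

theorem boole_weyl_functor_End: "boole_weyl_functor End_functor"
  unfolding boole_weyl_functor_def End_functor_simps
proof (intro conjI allI impI ballI)
  fix x :: "'a set" and T assume "T \<in> carrier (cube_End x)"
  then show "mor End_functor x x (\<lambda>a\<in>x. a) T = T"
    by (intro End_mor_eqI[OF id_mem_bijs] End_algebra_extensional) (simp_all add: push_id End_mem)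
next
  fix x y z :: "'a set" and \<sigma> \<tau> T
  assume \<sigma>: "\<sigma> \<in> bijs x y" and \<tau>: "\<tau> \<in> bijs y z"
  then show "mor End_functor x z (compose x \<tau> \<sigma>) T = mor End_functor y z \<tau> (mor End_functor x y \<sigma> T)"
    by (intro End_mor_eqI[OF compose_mem_bijs] End_mor_extensional)
      (simp_all add: push_compose[OF \<sigma> \<tau>] End_mor_apply)
qed (simp_all add: boole_weyl_End End_mor_hom)

lemma End_mor_generators:
  assumes "\<sigma> \<in> bijs x y" "a \<in> x"
  shows "mor End_functor x y \<sigma> (coord_mult x a) = coord_mult y (\<sigma> a)"
    "mor End_functor x y \<sigma> (bool_deriv x a) = bool_deriv y (\<sigma> a)"
proof -
  show "mor End_functor x y \<sigma> (coord_mult x a) = coord_mult y (\<sigma> a)"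
  proof (rule End_mor_eqI[OF assms(1)])
    show "coord_mult y (\<sigma> a) \<in> extensional (carrier (bool_functions y))"
      by (simp add: coord_mult_def)
  qed (rule push_coord_mult[OF assms])
  show "mor End_functor x y \<sigma> (bool_deriv x a) = bool_deriv y (\<sigma> a)"
  proof (rule End_mor_eqI[OF assms(1)])
    show "bool_deriv y (\<sigma> a) \<in> extensional (carrier (bool_functions y))"
      by (simp add: bool_deriv_def)
  qed (rule push_bool_deriv[OF assms])
qed

theorem proposition39:
  shows "boole_weyl_functor (oper_functor :: ('a, 'a oper set) bw_functor_data) \<and>
         boole_weyl_functor (End_functor ::
           ('a, (('a \<Rightarrow> bit) \<Rightarrow> bit) \<Rightarrow> (('a \<Rightarrow> bit) \<Rightarrow> bit)) bw_functor_data) \<and>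
         naturally_isomorphic (oper_functor :: ('a, 'a oper set) bw_functor_data) End_functor"
proof (intro conjI naturally_isomorphic_if_generators_natural boole_weyl_functor_oper
    boole_weyl_functor_End)
  fix x y :: "'a set" and \<sigma> a
  assume *: "finite x" "finite y" "\<sigma> \<in> bijs x y" "a \<in> x"
  show "mor oper_functor x y \<sigma> (genx oper_functor x a) = genx oper_functor y (\<sigma> a)"
    "mor oper_functor x y \<sigma> (geny oper_functor x a) = geny oper_functor y (\<sigma> a)"
    using * by (simp_all add: oper_functor_gens oper_mor_class opers.intros)
  show "mor End_functor x y \<sigma> (genx End_functor x a) = genx End_functor y (\<sigma> a)"
    "mor End_functor x y \<sigma> (geny End_functor x a) = geny End_functor y (\<sigma> a)"
    using * by (simp_all add: End_functor_simps End_mor_generators)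
qed

end
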